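(* Let $R$ be a commutative Noetherian domain of Krull dimension $d$ and $I$ an ideal of $R$. Let $A$ denote either $R[It]$ or $R[It,t^{-1}]$, and let $M$ be a non-zero finitely generated $A$-module. Then $M$ is generated by $e(M):=\sup_{\mathfrak p\in\mathrm{Spec}(A)}\{\mu_{\mathfrak p}(M)+\dim(A/\mathfrak p)\}$ elements.
   Context: For an ideal $I$ of $R$ and an indeterminate $t$, the Rees algebra is $R[It]=\bigoplus_{n\geq 0} I^n t^n\subset R[t]$, and the extended Rees algebra is $R[It,t^{-1}]=\bigoplus_{n\in\mathbb{Z}} I^n t^n\subset R[t,t^{-1}]$, where $I^n=R$ for $n\leq 0$. For a prime $\mathfrak p$ of $A$, $\mu_{\mathfrak p}(M)$ denotes the minimal number of generators of $M_{\mathfrak p}$ over $A_{\mathfrak p}$. *)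

theory Defs
  imports "HOL-Algebra.Algebra" "HOL-Library.Extended_Nat"
begin

primrec ideal_pow :: "('a, 'b) ring_scheme \<Rightarrow> 'a set \<Rightarrow> nat \<Rightarrow> 'a set" where
  "ideal_pow R I 0 = carrier R"
| "ideal_pow R I (Suc n) = ideal_prod R I (ideal_pow R I n)"

text \<open>An element of R[t,t^-1] is a finitely supported coefficient function int => R;
  the coefficient of t^n is f n.\<close>

definition laurent_mult :: "('a, 'b) ring_scheme \<Rightarrow> (int \<Rightarrow> 'a) \<Rightarrow> (int \<Rightarrow> 'a) \<Rightarrow> int \<Rightarrow> 'a" where
  "laurent_mult R f g n = (\<Oplus>\<^bsub>R\<^esub> k \<in> {k. f k \<noteq> \<zero>\<^bsub>R\<^esub>}. f k \<otimes>\<^bsub>R\<^esub> g (n - k))"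

definition laurent_ring :: "('a, 'b) ring_scheme \<Rightarrow> (int \<Rightarrow> 'a) ring" where
  "laurent_ring R =
     \<lparr> carrier = {f. (\<forall>n. f n \<in> carrier R) \<and> finite {n. f n \<noteq> \<zero>\<^bsub>R\<^esub>}},
       monoid.mult = laurent_mult R,
       monoid.one = (\<lambda>n. if n = 0 then \<one>\<^bsub>R\<^esub> else \<zero>\<^bsub>R\<^esub>),
       ring.zero = (\<lambda>n. \<zero>\<^bsub>R\<^esub>),
       ring.add = (\<lambda>f g n. f n \<oplus>\<^bsub>R\<^esub> g n) \<rparr>"

definition rees_algebra :: "('a, 'b) ring_scheme \<Rightarrow> 'a set \<Rightarrow> (int \<Rightarrow> 'a) ring" where
  "rees_algebra R I = (laurent_ring R) \<lparr> carrier :=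
     {f \<in> carrier (laurent_ring R).
        \<forall>n. f n \<in> (if n < 0 then {\<zero>\<^bsub>R\<^esub>} else ideal_pow R I (nat n))} \<rparr>"

text \<open>Extended Rees algebra R[It,t^-1] = sum over n in Z of I^n t^n, with I^n = R for n <= 0.\<close>
definition ext_rees_algebra :: "('a, 'b) ring_scheme \<Rightarrow> 'a set \<Rightarrow> (int \<Rightarrow> 'a) ring" where
  "ext_rees_algebra R I = (laurent_ring R) \<lparr> carrier :=
     {f \<in> carrier (laurent_ring R). \<forall>n. f n \<in> ideal_pow R I (nat n)} \<rparr>"

definition krull_dim :: "('a, 'b) ring_scheme \<Rightarrow> enat" where
  "krull_dim R = Sup {enat n | n. \<exists>C :: nat \<Rightarrow> 'a set.
       (\<forall>i \<le> n. primeideal (C i) R) \<and> (\<forall>i < n. C i \<subset> C (Suc i))}"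

definition mod_span :: "('x, 'c) ring_scheme \<Rightarrow> ('x, 'm, 'd) module_scheme \<Rightarrow> 'm set \<Rightarrow> 'm set" where
  "mod_span A M S = {x. \<exists>a. a \<in> S \<rightarrow> carrier A \<and> x = (\<Oplus>\<^bsub>M\<^esub> m \<in> S. a m \<odot>\<^bsub>M\<^esub> m)}"

definition fin_gen_module :: "('x, 'c) ring_scheme \<Rightarrow> ('x, 'm, 'd) module_scheme \<Rightarrow> bool" where
  "fin_gen_module A M \<longleftrightarrow> (\<exists>S. finite S \<and> S \<subseteq> carrier M \<and> mod_span A M S = carrier M)"

text \<open>The images of the elements of S generate the localization M_P over A_P, i.e.
  for every m in M there is s in A - P with s m in the A-span of S
  (standard unfolding of the localization M_P = (A-P)^{-1} M; every element of M_P is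
  a unit multiple of an element m/1).\<close>
definition loc_generates ::
  "('x, 'c) ring_scheme \<Rightarrow> ('x, 'm, 'd) module_scheme \<Rightarrow> 'x set \<Rightarrow> 'm set \<Rightarrow> bool" where
  "loc_generates A M P S \<longleftrightarrow>
     (\<forall>m \<in> carrier M. \<exists>s \<in> carrier A - P. s \<odot>\<^bsub>M\<^esub> m \<in> mod_span A M S)"

definition mu_loc :: "('x, 'c) ring_scheme \<Rightarrow> ('x, 'm, 'd) module_scheme \<Rightarrow> 'x set \<Rightarrow> nat" where
  "mu_loc A M P = (LEAST n. \<exists>S. finite S \<and> S \<subseteq> carrier M \<and> card S = n \<and> loc_generates A M P S)"

definition e_inv :: "('x, 'c) ring_scheme \<Rightarrow> ('x, 'm, 'd) module_scheme \<Rightarrow> enat" where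
  "e_inv A M = (SUP P \<in> {P. primeideal P A}. enat (mu_loc A M P) + krull_dim (A Quot P))"

end

theory Submission
  imports Defs
begin

text \<open>
  This is the Forster--Swan theorem, which in Heitmann's form holds over every commutative ring; the
  argument is that of Coquand, Lombardi and Quitte. Let \<open>M\<close> be generated by \<open>u\<close> and \<open>x\<^sub>i\<close> with \<open>i \<in> I\<close>, where
  \<open>card I \<ge> e(M)\<close>. One looks for \<open>t\<^sub>i\<close> such that the \<open>x\<^sub>i + t\<^sub>i u\<close> alone generate \<open>M\<close>, that is,
  such that no prime contains the ideal of all \<open>a\<close> with \<open>a u\<close> in their span. This is achieved
  successively on the sets of primes where at least \<open>card I + 1 - k\<close> generators are needed, for
  \<open>k = 0, 1, \<dots>\<close>; on the \<open>k\<close>-th of them chains of primes have length less than \<open>k\<close>, so Kronecker's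
  theorem applies to \<open>k\<close> elements.
\<close>

section \<open>Prime ideals avoiding a multiplicative set\<close>

text \<open>Zorn's lemma gives an ideal maximal among those that contain \<open>I\<close> and are
  disjoint from \<open>T\<close>. If it contained neither \<open>a\<close> nor \<open>b\<close>,
  enlarging it by either one would meet \<open>T\<close>; the product of the two common elements
  lies in \<open>T\<close>, and also in the ideal if \<open>a \<otimes> b\<close> does.\<close>

lemma (in cring) exists_primeideal_disjoint:
  assumes I: "ideal I R" and one: "\<one> \<in> T"
    and mult: "\<And>s t. s \<in> T \<Longrightarrow> t \<in> T \<Longrightarrow> s \<otimes> t \<in> T" and disj: "I \<inter> T = {}"
  obtains P where "primeideal P R" "I \<subseteq> P" "P \<inter> T = {}"
proof -
  define F where "F = {J. ideal J R \<and> I \<subseteq> J \<and> J \<inter> T = {}}"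
  have "\<exists>P\<in>F. \<forall>H\<in>F. P \<subseteq> H \<longrightarrow> H = P"
  proof (rule subset_Zorn_nonempty)
    show "F \<noteq> {}" using I disj by (auto simp: F_def)
    fix C assume C: "C \<noteq> {}" "subset.chain F C"
    then have "subset.chain {J. ideal J R} C"
      unfolding pred_on.chain_def F_def by blast
    then have "ideal (\<Union>C) R" using chain_Union_is_ideal[of C] C(1) by simp
    moreover have "C \<subseteq> F" using C(2) unfolding pred_on.chain_def by blast
    ultimately show "\<Union>C \<in> F" using C(1) by (auto simp: F_def)
  qed
  then obtain P where PF: "P \<in> F" and PH: "\<And>H. H \<in> F \<Longrightarrow> P \<subseteq> H \<Longrightarrow> H = P" by blast
  have P: "ideal P R" "I \<subseteq> P" "P \<inter> T = {}" using PF by (simp_all add: F_def)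
  have max: "H = P" if "ideal H R" "I \<subseteq> H" "H \<inter> T = {}" "P \<subseteq> H" for H
    using PH[of H] that by (simp add: F_def)
  interpret P: ideal P R by fact
  have meets: "\<exists>p\<in>P. \<exists>r\<in>carrier R. p \<oplus> r \<otimes> a \<in> T" if a: "a \<in> carrier R" "a \<notin> P" for a
  proof -
    have id: "ideal (P <+> PIdl a) R" by (intro add_ideals P(1) cgenideal_ideal a(1))
    have "P \<union> PIdl a \<subseteq> P <+> PIdl a"
      using union_genideal[OF P(1) cgenideal_ideal[OF a(1)]]
        genideal_self[of "P \<union> PIdl a"] P.a_subset ideal.Icarr[OF cgenideal_ideal[OF a(1)]] by blast
    moreover have "a \<in> PIdl a" by (rule cgenideal_self) fact
    ultimately have "(P <+> PIdl a) \<inter> T \<noteq> {}"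
      using max[OF id] P(2) a(2) by blast
    then show ?thesis by (auto simp: set_add_defs cgenideal_def)
  qed
  have "primeideal P R"
  proof (rule primeidealI)
    show "carrier R \<noteq> P" using one P(3) by auto
    fix a b assume ab: "a \<in> carrier R" "b \<in> carrier R" "a \<otimes> b \<in> P"
    show "a \<in> P \<or> b \<in> P"
    proof (rule ccontr)
      assume "\<not> (a \<in> P \<or> b \<in> P)"
      then obtain p r q s where *: "p \<in> P" "r \<in> carrier R" "p \<oplus> r \<otimes> a \<in> T"
        "q \<in> P" "s \<in> carrier R" "q \<oplus> s \<otimes> b \<in> T" using meets[of a] meets[of b] ab by blast
      have "(p \<oplus> r \<otimes> a) \<otimes> (q \<oplus> s \<otimes> b) = p \<otimes> (q \<oplus> s \<otimes> b) \<oplus> ((r \<otimes> a) \<otimes> q \<oplus> (r \<otimes> s) \<otimes> (a \<otimes> b))"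
        using * ab P.Icarr by algebra
      moreover have "\<dots> \<in> P" using * ab P.Icarr
        by (simp add: P.a_closed P.I_l_closed P.I_r_closed)
      ultimately show False using mult[OF *(3,6)] P(3) by auto
    qed
  qed (use P is_cring in auto)
  then show thesis using P that by blast
qed

lemma (in primeideal) one_notin: "\<one> \<notin> I"
  using one_imp_carrier I_notcarr by blast

lemma (in primeideal) pow_mem_imp_mem:
  assumes "a \<in> carrier R" "a [^] (n::nat) \<in> I" shows "a \<in> I"
  using assms(2)
proof (induction n)
  case 0 then show ?case using one_imp_carrier I_notcarr by simp
next
  case (Suc n) then show ?case using I_prime[of "a [^] n" a] assms(1) by auto
qed

text \<open>Otherwise the powers of \<open>a\<close> form a multiplicative set disjoint from
  \<open>Idl H\<close>, and a prime avoiding that set contains \<open>H\<close> but not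
  \<open>a\<close>.\<close>

lemma (in cring) pow_mem_Idl_if_mem_primeideals:
  assumes H: "H \<subseteq> carrier R" and a: "a \<in> carrier R"
    and all: "\<And>P. primeideal P R \<Longrightarrow> H \<subseteq> P \<Longrightarrow> a \<in> P"
  shows "\<exists>n::nat. a [^] n \<in> Idl H"
proof (rule ccontr)
  assume no: "\<not> ?thesis"
  let ?T = "range (\<lambda>n::nat. a [^] n)"
  have "\<one> \<in> ?T" by (rule range_eqI[of _ _ 0]) simp
  moreover have "s \<otimes> t \<in> ?T" if "s \<in> ?T" "t \<in> ?T" for s t
    using that nat_pow_mult[OF a] by auto
  ultimately obtain P where P: "primeideal P R" "Idl H \<subseteq> P" "P \<inter> ?T = {}"
    using exists_primeideal_disjoint[OF genideal_ideal[OF H], of ?T] no by blast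
  then have "a \<in> P" using all genideal_self[OF H] by blast
  moreover have "a \<in> ?T" by (rule range_eqI[of _ _ 1]) (use a in simp)
  ultimately show False using P(3) by blast
qed

lemma (in cring) one_mem_Idl_if_no_primeideal:
  assumes H: "H \<subseteq> carrier R" and "\<And>P. primeideal P R \<Longrightarrow> \<not> H \<subseteq> P"
  shows "\<one> \<in> Idl H"
  using pow_mem_Idl_if_mem_primeideals[OF H one_closed] assms(2) by auto

section \<open>Chains of primes and Kronecker's theorem\<close>

text \<open>A chain starting at \<open>P\<close> witnesses dim(R/P) \<ge> n. Accordingly, the
  absence of such chains for all \<open>P\<close> containing a set \<open>J\<close> expresses
  dim(R/J) < n; for \<open>n = 0\<close> it means that no prime contains \<open>J\<close>.\<close>

definition prime_chain :: "('a, 'b) ring_scheme \<Rightarrow> 'a set \<Rightarrow> nat \<Rightarrow> bool" where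
  "prime_chain R P n \<longleftrightarrow> (\<exists>C. C 0 = P \<and> (\<forall>i \<le> n. primeideal (C i) R) \<and> (\<forall>i < n. C i \<subset> C (Suc i)))"

lemma prime_chain_0: "primeideal P R \<Longrightarrow> prime_chain R P 0"
  unfolding prime_chain_def by (intro exI[of _ "\<lambda>_. P"]) auto

lemma prime_chain_Suc:
  assumes "prime_chain R P n" "primeideal Q R" "Q \<subset> P"
  shows "prime_chain R Q (Suc n)"
proof -
  obtain C where C: "C 0 = P" "\<forall>i \<le> n. primeideal (C i) R" "\<forall>i < n. C i \<subset> C (Suc i)"
    using assms(1) unfolding prime_chain_def by blast
  let ?C = "case_nat Q C"
  have "primeideal (?C i) R" if "i \<le> Suc n" for i
    using that C(2) assms(2) by (cases i) auto
  moreover have "?C i \<subset> ?C (Suc i)" if "i < Suc n" for i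
    using that C(1,3) assms(3) by (cases i) auto
  ultimately show ?thesis unfolding prime_chain_def by (intro exI[of _ ?C]) auto
qed

lemma prime_chain_primeideal: "prime_chain R P n \<Longrightarrow> primeideal P R"
  unfolding prime_chain_def by auto

text \<open>The primes \<open>P\<close> below are those that contain the Krull boundary of \<open>b\<close>, the ideal generated
  by \<open>b\<close> and the colon ideal \<open>\<surd>J : b\<close>.\<close>

lemma (in cring) primeideal_below_boundary:
  assumes J: "J \<subseteq> carrier R" and b: "b \<in> P" and P: "primeideal P R"
    and colon: "\<And>s. s \<in> carrier R \<Longrightarrow> (\<And>Q. primeideal Q R \<Longrightarrow> J \<subseteq> Q \<Longrightarrow> b \<otimes> s \<in> Q) \<Longrightarrow> s \<in> P"
  obtains Q where "primeideal Q R" "J \<subseteq> Q" "Q \<subset> P"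
proof -
  interpret P: primeideal P R by fact
  have bc: "b \<in> carrier R" using b P.Icarr by blast
  have one: "\<one> \<notin> P" by (rule P.one_notin)
  \<comment> \<open>A prime disjoint from \<open>T\<close> is contained in \<open>P\<close>, by the
    factors \<open>s\<close>, and omits \<open>b\<close>, by the powers of \<open>b\<close>; since
    \<open>b\<close> is in \<open>P\<close>, it is strictly smaller than \<open>P\<close>.\<close>
  define T where "T = {s \<otimes> b [^] n | s (n::nat). s \<in> carrier R - P}"
  have TI: "s \<otimes> b [^] n \<in> T" if "s \<in> carrier R" "s \<notin> P" for s and n :: nat
    using that unfolding T_def by auto
  have "\<one> \<in> T" using TI[OF one_closed one, of 0] by simp
  moreover have "x \<otimes> y \<in> T" if xy: "x \<in> T" "y \<in> T" for x y
  proof -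
    obtain s m t n where "s \<in> carrier R" "s \<notin> P" "t \<in> carrier R" "t \<notin> P"
      "x = s \<otimes> b [^] (m::nat)" "y = t \<otimes> b [^] (n::nat)"
      using xy unfolding T_def by auto
    moreover from this have "x \<otimes> y = (s \<otimes> t) \<otimes> b [^] (m + n)"
      using bc by (simp add: nat_pow_mult[symmetric] m_ac)
    ultimately show ?thesis using TI[of "s \<otimes> t" "m + n"] P.I_prime by auto
  qed
  moreover have "Idl J \<inter> T = {}"
  proof (rule ccontr)
    assume "Idl J \<inter> T \<noteq> {}"
    then obtain s n where s: "s \<in> carrier R" "s \<notin> P" "s \<otimes> b [^] (n::nat) \<in> Idl J"
      unfolding T_def by auto
    \<comment> \<open>An element \<open>s \<otimes> b [^] n\<close> of \<open>Idl J\<close> forces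
      every prime over \<open>J\<close> to contain \<open>s\<close> or \<open>b\<close>, so
      \<open>s\<close> belongs to the colon ideal, which \<open>P\<close> contains.\<close>
    have "b \<otimes> s \<in> Q" if Q: "primeideal Q R" "J \<subseteq> Q" for Q
    proof -
      interpret Q: primeideal Q R by fact
      have "s \<otimes> b [^] n \<in> Q" using s(3) genideal_minimal[OF Q.is_ideal Q(2)] by blast
      then have "s \<in> Q \<or> b \<in> Q"
        using Q.I_prime[of s "b [^] n"] Q.pow_mem_imp_mem[OF bc] s bc by auto
      then show ?thesis using s(1) bc Q.I_l_closed Q.I_r_closed by auto
    qed
    then show False using colon s by blast
  qed
  ultimately obtain Q where Q: "primeideal Q R" "Idl J \<subseteq> Q" "Q \<inter> T = {}"
    using exists_primeideal_disjoint[OF genideal_ideal[OF J], of T] by blast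
  interpret Q: primeideal Q R by fact
  have "x \<in> P" if "x \<in> Q" for x
    using TI[of x 0] that Q.Icarr[OF that] Q(3) by auto
  moreover have "b \<notin> Q" using TI[OF one_closed one, of 1] bc Q(3) by auto
  ultimately show thesis using that[OF Q(1)] Q(2) genideal_self[OF J] b by blast
qed

text \<open>Kronecker's theorem for \<open>R/J\<close>. Passing to the Krull boundary of one \<open>b i\<close> lowers the dimension;
  a power of \<open>a\<close> involves a single element of \<open>\<surd>J : b i\<close>, and this element serves as \<open>y i\<close>.\<close>

lemma (in cring) kronecker:
  assumes "finite S" "J \<subseteq> carrier R" "b \<in> S \<rightarrow> carrier R" "a \<in> carrier R"
    and "\<And>P. J \<subseteq> P \<Longrightarrow> \<not> prime_chain R P (card S)"
  shows "\<exists>y \<in> S \<rightarrow> carrier R. \<forall>P. primeideal P R \<longrightarrow> J \<subseteq> P \<longrightarrow> (\<forall>i\<in>S. b i \<oplus> a \<otimes> y i \<in> P) \<longrightarrow> a \<in> P"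
  using assms
proof (induction S arbitrary: J rule: finite_induct)
  \<comment> \<open>A chain of length 0 is a single prime, so the dimension hypothesis says that no
    prime contains \<open>J\<close>.\<close>
  case empty
  then show ?case using prime_chain_0 by auto
next
  case (insert i S)
  note J = insert.prems(1) and a = insert.prems(3)
  have bi: "b i \<in> carrier R" and bS: "b \<in> S \<rightarrow> carrier R" using insert.prems(2) by auto
  define C where "C = {c \<in> carrier R. \<forall>P. primeideal P R \<longrightarrow> J \<subseteq> P \<longrightarrow> b i \<otimes> c \<in> P}"
  have Cc: "C \<subseteq> carrier R" unfolding C_def by blast
  have sub: "additive_subgroup P R" if "primeideal P R" for P
    using that by (intro ideal.axioms(1) primeideal.axioms(1))
  have C: "ideal C R"
  proof (rule idealI)
    show "subgroup C (add_monoid R)"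
    proof (rule add.subgroupI)
      have "\<zero> \<in> C" using bi sub by (auto simp: C_def additive_subgroup.zero_closed)
      then show "C \<noteq> {}" by blast
      fix c d assume cd: "c \<in> C" "d \<in> C"
      show "\<ominus> c \<in> C" using cd(1) bi sub unfolding C_def
        by (auto simp: r_minus additive_subgroup.a_inv_closed)
      show "c \<oplus> d \<in> C" using cd bi sub unfolding C_def
        by (auto simp: r_distr additive_subgroup.a_closed)
    qed (auto simp: C_def)
    fix c r assume c: "c \<in> C" and r: "r \<in> carrier R"
    have "b i \<otimes> (c \<otimes> r) \<in> P" if P: "primeideal P R" "J \<subseteq> P" for P
    proof -
      have "(b i \<otimes> c) \<otimes> r \<in> P"
        using c r P unfolding C_def by (auto intro: ideal.I_r_closed primeideal.axioms(1))
      then show ?thesis using c r bi Cc by (simp add: m_assoc C_def)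
    qed
    then show "c \<otimes> r \<in> C" using c r by (auto simp: C_def)
    then show "r \<otimes> c \<in> C" using m_comm[of c r] c r Cc by auto
  qed (fact ring_axioms)
  have JC: "J \<subseteq> C" unfolding C_def using J bi
    by (auto intro: ideal.I_l_closed primeideal.axioms(1))
  \<comment> \<open>This set generates the Krull boundary of \<open>b i\<close>. Below any prime
    containing it there is a strictly smaller prime over \<open>J\<close>, which would lengthen a
    chain by one; so the dimension bound drops from \<open>card (insert i S)\<close> to
    \<open>card S\<close>.\<close>
  let ?J = "insert (b i) C"
  have "\<not> prime_chain R P (card S)" if P: "?J \<subseteq> P" for P
  proof
    assume ch: "prime_chain R P (card S)"
    have "b i \<in> P" using P by blast
    then obtain Q where Q: "primeideal Q R" "J \<subseteq> Q" "Q \<subset> P"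
    proof (rule primeideal_below_boundary[OF J _ prime_chain_primeideal[OF ch]])
      fix s assume "s \<in> carrier R" "\<And>Q. primeideal Q R \<Longrightarrow> J \<subseteq> Q \<Longrightarrow> b i \<otimes> s \<in> Q"
      then show "s \<in> P" using P unfolding C_def by auto
    qed
    have "prime_chain R Q (card (insert i S))"
      using prime_chain_Suc[OF ch Q(1,3)] insert.hyps by simp
    then show False using insert.prems(4)[OF Q(2)] by contradiction
  qed
  then obtain y where y: "y \<in> S \<rightarrow> carrier R"
    "\<And>P. primeideal P R \<Longrightarrow> ?J \<subseteq> P \<Longrightarrow> (\<forall>j\<in>S. b j \<oplus> a \<otimes> y j \<in> P) \<Longrightarrow> a \<in> P"
    using insert.IH[of ?J] Cc bi bS a by auto
  let ?Y = "insert (b i) ((\<lambda>j. b j \<oplus> a \<otimes> y j) ` S)"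
  have Y: "?Y \<subseteq> carrier R" using y(1) bS bi a by auto
  \<comment> \<open>The inner \<open>Idl\<close> makes both sets ideals, so that the ideal generated
    by their union is their sum and the power of \<open>a\<close> splits as
    \<open>c \<oplus> w\<close>.\<close>
  have "\<exists>n::nat. a [^] n \<in> Idl (C \<union> Idl ?Y)"
  proof (rule pow_mem_Idl_if_mem_primeideals)
    show "C \<union> Idl ?Y \<subseteq> carrier R" using Cc ideal.Icarr[OF genideal_ideal[OF Y]] by blast
    fix P assume "primeideal P R" "C \<union> Idl ?Y \<subseteq> P"
    then show "a \<in> P" using y(2)[of P] genideal_self[OF Y] by blast
  qed fact
  then obtain n :: nat and c w where c: "c \<in> C" and w: "w \<in> Idl ?Y" and eq: "a [^] n = c \<oplus> w"
    unfolding union_genideal[OF C genideal_ideal[OF Y]] by (auto simp: set_add_defs)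
  have cc: "c \<in> carrier R" using c Cc by blast
  show ?case
  proof (intro bexI[of _ "y(i := c)"] allI impI)
    show "y(i := c) \<in> insert i S \<rightarrow> carrier R" using y(1) cc by auto
    fix P assume P: "primeideal P R" "J \<subseteq> P" and *: "\<forall>j\<in>insert i S. b j \<oplus> a \<otimes> (y(i := c)) j \<in> P"
    interpret P: primeideal P R by fact
    have S: "b j \<oplus> a \<otimes> y j \<in> P" if "j \<in> S" for j using bspec[OF *, of j] that insert.hyps by (cases "j = i") auto
    have i: "b i \<oplus> a \<otimes> c \<in> P" using * by simp
    \<comment> \<open>One of \<open>b i\<close> and \<open>c\<close> is in \<open>P\<close>; as
      \<open>b i \<oplus> a \<otimes> c\<close> is in \<open>P\<close> too, \<open>b i\<close> is in
      \<open>P\<close> in both cases. Then \<open>a \<otimes> c\<close> is in \<open>P\<close>, and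
      if \<open>c\<close> is, then so is \<open>a [^] n = c \<oplus> w\<close>.\<close>
    have "b i \<otimes> c \<in> P" using c P unfolding C_def by blast
    then have "b i \<in> P \<or> c \<in> P" using P.I_prime bi cc by blast
    then have bP: "b i \<in> P"
    proof
      assume "c \<in> P"
      then have "(b i \<oplus> a \<otimes> c) \<ominus> a \<otimes> c \<in> P" using i a P.I_l_closed by (simp add: P.a_closed P.a_inv_closed a_minus_def)
      moreover have "(b i \<oplus> a \<otimes> c) \<ominus> a \<otimes> c = b i" using bi a cc by algebra
      ultimately show ?thesis by simp
    qed
    then have "(b i \<oplus> a \<otimes> c) \<ominus> b i \<in> P" using i by (simp add: P.a_closed P.a_inv_closed a_minus_def)
    moreover have "(b i \<oplus> a \<otimes> c) \<ominus> b i = a \<otimes> c" using bi a cc by algebra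
    ultimately have "a \<in> P \<or> c \<in> P" using P.I_prime a cc by metis
    moreover have "a \<in> P" if "c \<in> P"
    proof -
      have "Idl ?Y \<subseteq> P" using bP S by (intro genideal_minimal P.is_ideal) auto
      then have "a [^] n \<in> P" unfolding eq using w that by (auto intro: P.a_closed)
      then show ?thesis using P.pow_mem_imp_mem a by blast
    qed
    ultimately show "a \<in> P" by blast
  qed
qed

section \<open>Chains of primes and the Krull dimension of a quotient\<close>

text \<open>By the second claim, distinct primes above \<open>P\<close> have distinct images, so
  that strict chains remain strict in the quotient.\<close>

lemma (in cring) primeideal_image_Quot:
  assumes P: "ideal P R" and Q: "primeideal Q R" and PQ: "P \<subseteq> Q"
  shows "primeideal ((+>) P ` Q) (R Quot P)"
    and "\<And>a. a \<in> carrier R \<Longrightarrow> P +> a \<in> (+>) P ` Q \<longleftrightarrow> a \<in> Q"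
proof -
  interpret P: ideal P R by fact
  interpret Q: primeideal Q R by fact
  show mem: "P +> a \<in> (+>) P ` Q \<longleftrightarrow> a \<in> Q" if a: "a \<in> carrier R" for a
  proof
    assume "P +> a \<in> (+>) P ` Q"
    then obtain q where q: "q \<in> Q" "P +> a = P +> q" by blast
    then have "a \<in> P +> q" using P.a_rcos_self[OF a] by simp
    then obtain p where "p \<in> P" "a = p \<oplus> q" by (auto simp: a_r_coset_def r_coset_def)
    then show "a \<in> Q" using q PQ Q.a_closed by auto
  qed auto
  have carr: "\<exists>a\<in>carrier R. x = P +> a" if "x \<in> carrier (R Quot P)" for x
    using that by (auto simp: FactRing_def A_RCOSETS_def')
  show "primeideal ((+>) P ` Q) (R Quot P)"
  proof (rule primeidealI)
    show "ideal ((+>) P ` Q) (R Quot P)" by (rule ring_ideal_imp_quot_ideal[OF P Q.is_ideal])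
    show "cring (R Quot P)" by (rule P.quotient_is_cring[OF is_cring])
    have "\<one> \<notin> Q" by (rule Q.one_notin)
    then have "P +> \<one> \<notin> (+>) P ` Q" using mem by simp
    moreover have "P +> \<one> \<in> carrier (R Quot P)" by (auto simp: FactRing_def A_RCOSETS_def')
    ultimately show "carrier (R Quot P) \<noteq> (+>) P ` Q" by blast
    fix x y assume xy: "x \<in> carrier (R Quot P)" "y \<in> carrier (R Quot P)"
      "x \<otimes>\<^bsub>R Quot P\<^esub> y \<in> (+>) P ` Q"
    obtain a b where ab: "a \<in> carrier R" "b \<in> carrier R" "x = P +> a" "y = P +> b"
      using carr[OF xy(1)] carr[OF xy(2)] by blast
    then have "P +> a \<otimes> b \<in> (+>) P ` Q" using xy(3) by (simp add: FactRing_def P.rcoset_mult_add)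
    then have "a \<otimes> b \<in> Q" using mem ab by simp
    then show "x \<in> (+>) P ` Q \<or> y \<in> (+>) P ` Q" using Q.I_prime ab by auto
  qed
qed

lemma (in cring) krull_dim_Quot_ge:
  assumes "prime_chain R P n" shows "enat n \<le> krull_dim (R Quot P)"
proof -
  obtain C where C: "C 0 = P" "\<And>i. i \<le> n \<Longrightarrow> primeideal (C i) R" "\<And>i. i < n \<Longrightarrow> C i \<subset> C (Suc i)"
    using assms unfolding prime_chain_def by blast
  have P: "ideal P R" using prime_chain_primeideal[OF assms] by (rule primeideal.axioms)
  have sub: "P \<subseteq> C i" if "i \<le> n" for i
    using that
  proof (induction i)
    case (Suc i) then show ?case using C(3)[of i] by auto
  qed (simp add: C(1))
  let ?D = "\<lambda>i. (+>) P ` C i"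
  have "primeideal (?D i) (R Quot P)" if "i \<le> n" for i
    by (rule primeideal_image_Quot(1)[OF P C(2)[OF that] sub[OF that]])
  moreover have "?D i \<subset> ?D (Suc i)" if i: "i < n" for i
  proof -
    obtain a where a: "a \<in> C (Suc i)" "a \<notin> C i" using C(3)[OF i] by blast
    then have "a \<in> carrier R" using C(2)[of "Suc i"] i by (auto dest: ideal.Icarr[OF primeideal.axioms(1)])
    then have "P +> a \<notin> ?D i" using primeideal_image_Quot(2)[OF P C(2)[of i] sub[of i]] a i by simp
    moreover have "P +> a \<in> ?D (Suc i)" using a by blast
    ultimately show ?thesis using C(3)[OF i] by blast
  qed
  ultimately have "(\<forall>i \<le> n. primeideal (?D i) (R Quot P)) \<and> (\<forall>i < n. ?D i \<subset> ?D (Suc i))"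
    by simp
  then have "\<exists>C. (\<forall>i \<le> n. primeideal (C i) (R Quot P)) \<and> (\<forall>i < n. C i \<subset> C (Suc i))"
    by (rule exI[of _ ?D])
  then show ?thesis unfolding krull_dim_def by (intro Sup_upper) simp
qed

section \<open>Spans in a module\<close>

text \<open>The inductive form admits arbitrary \<open>G\<close> and induction on elements without
  finite sums; for finite \<open>G\<close> inside the module it agrees with \<open>mod_span\<close>
  by \<open>mod_span_eq_lspan\<close>.\<close>

inductive_set lspan :: "('x, 'c) ring_scheme \<Rightarrow> ('x, 'm, 'd) module_scheme \<Rightarrow> 'm set \<Rightarrow> 'm set"
  for A M G where
  zero: "\<zero>\<^bsub>M\<^esub> \<in> lspan A M G"
| step: "\<lbrakk>a \<in> carrier A; x \<in> G; y \<in> lspan A M G\<rbrakk> \<Longrightarrow> a \<odot>\<^bsub>M\<^esub> x \<oplus>\<^bsub>M\<^esub> y \<in> lspan A M G"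

context module
begin

lemma submoduleI_no_uminus:
  assumes "H \<subseteq> carrier M" "\<zero>\<^bsub>M\<^esub> \<in> H"
    and "\<And>x y. x \<in> H \<Longrightarrow> y \<in> H \<Longrightarrow> x \<oplus>\<^bsub>M\<^esub> y \<in> H"
    and smult: "\<And>a x. a \<in> carrier R \<Longrightarrow> x \<in> H \<Longrightarrow> a \<odot>\<^bsub>M\<^esub> x \<in> H"
  shows "submodule H R M"
proof (rule submoduleI)
  fix x assume x: "x \<in> H"
  then have "(\<ominus> \<one>) \<odot>\<^bsub>M\<^esub> x = \<ominus>\<^bsub>M\<^esub> x" using assms(1) by (subst smult_l_minus) auto
  then show "\<ominus>\<^bsub>M\<^esub> x \<in> H" using smult[of "\<ominus> \<one>" x] x by auto
qed (use assms in auto)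

lemma lspan_subset_carrier: "G \<subseteq> carrier M \<Longrightarrow> lspan R M G \<subseteq> carrier M"
proof
  fix y assume "G \<subseteq> carrier M" "y \<in> lspan R M G"
  from this(2,1) show "y \<in> carrier M" by (induction rule: lspan.induct) auto
qed

lemma lspan_superset: assumes "G \<subseteq> carrier M" shows "G \<subseteq> lspan R M G"
proof
  fix x assume x: "x \<in> G"
  then have "\<one> \<odot>\<^bsub>M\<^esub> x \<oplus>\<^bsub>M\<^esub> \<zero>\<^bsub>M\<^esub> \<in> lspan R M G" by (intro lspan.intros) auto
  then show "x \<in> lspan R M G" using x assms by auto
qed

lemma lspan_submodule:
  assumes G: "G \<subseteq> carrier M" shows "submodule (lspan R M G) R M"
proof (rule submoduleI_no_uminus)
  note c = lspan_subset_carrier[OF G]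
  show "lspan R M G \<subseteq> carrier M" by (fact c)
  show "\<zero>\<^bsub>M\<^esub> \<in> lspan R M G" by (rule lspan.zero)
  fix x y assume x: "x \<in> lspan R M G" and y: "y \<in> lspan R M G"
  from x show "x \<oplus>\<^bsub>M\<^esub> y \<in> lspan R M G"
  proof (induction rule: lspan.induct)
    case zero then show ?case using y c by auto
  next
    case (step a g z)
    then have "a \<odot>\<^bsub>M\<^esub> g \<oplus>\<^bsub>M\<^esub> z \<oplus>\<^bsub>M\<^esub> y = a \<odot>\<^bsub>M\<^esub> g \<oplus>\<^bsub>M\<^esub> (z \<oplus>\<^bsub>M\<^esub> y)"
      using y c G by (intro M.a_assoc) auto
    then show ?case using step by (auto intro: lspan.step)
  qed
next
  fix a x assume a: "a \<in> carrier R" and x: "x \<in> lspan R M G"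
  from x show "a \<odot>\<^bsub>M\<^esub> x \<in> lspan R M G"
  proof (induction rule: lspan.induct)
    case zero then show ?case using a by (simp add: lspan.zero)
  next
    case (step b g z)
    then have "z \<in> carrier M" "g \<in> carrier M" using lspan_subset_carrier[OF G] G by auto
    then have "a \<odot>\<^bsub>M\<^esub> (b \<odot>\<^bsub>M\<^esub> g \<oplus>\<^bsub>M\<^esub> z) = (a \<otimes> b) \<odot>\<^bsub>M\<^esub> g \<oplus>\<^bsub>M\<^esub> a \<odot>\<^bsub>M\<^esub> z"
      using a step by (simp add: smult_r_distr smult_assoc1)
    then show ?case using step a by (auto intro: lspan.step)
  qed
qed

lemma submodule_zero: "submodule N R M \<Longrightarrow> \<zero>\<^bsub>M\<^esub> \<in> N"
  using submodule.axioms(1) subgroup.one_closed by fastforce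

lemma submodule_minus:
  assumes "submodule N R M" "x \<in> N" "y \<in> N" shows "x \<ominus>\<^bsub>M\<^esub> y \<in> N"
  using submoduleE(5)[OF assms(1,2) submoduleE(3)[OF assms(1,3)]] by (simp add: a_minus_def)

lemma lspan_least:
  assumes N: "submodule N R M" and G: "G \<subseteq> N" shows "lspan R M G \<subseteq> N"
proof
  fix y assume "y \<in> lspan R M G"
  then show "y \<in> N"
  proof (induction rule: lspan.induct)
    case zero then show ?case by (rule submodule_zero[OF N])
  next
    case (step a x y) then show ?case
      using submoduleE(4,5)[OF N] G by blast
  qed
qed

lemma lspan_mono: "G \<subseteq> H \<Longrightarrow> H \<subseteq> carrier M \<Longrightarrow> lspan R M G \<subseteq> lspan R M H"
  by (meson lspan_least lspan_submodule lspan_superset subset_trans)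

lemma lspan_insertE:
  assumes "y \<in> lspan R M (insert x G)" "x \<in> carrier M" "G \<subseteq> carrier M"
  obtains c z where "c \<in> carrier R" "z \<in> lspan R M G" "y = c \<odot>\<^bsub>M\<^esub> x \<oplus>\<^bsub>M\<^esub> z"
proof -
  note c = lspan_subset_carrier[OF assms(3)]
  have "\<exists>c\<in>carrier R. \<exists>z\<in>lspan R M G. y = c \<odot>\<^bsub>M\<^esub> x \<oplus>\<^bsub>M\<^esub> z"
    using assms(1)
  proof (induction rule: lspan.induct)
    case zero
    show ?case using assms(2) by (intro bexI[of _ \<zero>] bexI[OF _ lspan.zero]) auto
  next
    case (step a g y)
    then obtain d z where dz: "d \<in> carrier R" "z \<in> lspan R M G" "y = d \<odot>\<^bsub>M\<^esub> x \<oplus>\<^bsub>M\<^esub> z" by blast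
    then have zc: "z \<in> carrier M" using c by blast
    show ?case
    proof (cases "g = x")
      case True
      then have "a \<odot>\<^bsub>M\<^esub> g \<oplus>\<^bsub>M\<^esub> y = (a \<oplus> d) \<odot>\<^bsub>M\<^esub> x \<oplus>\<^bsub>M\<^esub> z"
        using dz zc step assms(2) by (simp add: smult_l_distr M.a_assoc)
      then show ?thesis using dz step by (intro bexI[of _ "a \<oplus> d"] bexI[of _ z]) auto
    next
      case False
      then have g: "g \<in> G" "g \<in> carrier M" using step assms by auto
      then have "a \<odot>\<^bsub>M\<^esub> g \<oplus>\<^bsub>M\<^esub> y = d \<odot>\<^bsub>M\<^esub> x \<oplus>\<^bsub>M\<^esub> (a \<odot>\<^bsub>M\<^esub> g \<oplus>\<^bsub>M\<^esub> z)"
        using dz zc step assms(2) by (simp add: M.a_lcomm)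
      moreover have "a \<odot>\<^bsub>M\<^esub> g \<oplus>\<^bsub>M\<^esub> z \<in> lspan R M G" using g dz step by (auto intro: lspan.step)
      ultimately show ?thesis using dz by blast
    qed
  qed
  then show thesis using that by blast
qed

lemma mod_span_eq_lspan:
  assumes S: "finite S" "S \<subseteq> carrier M" shows "mod_span R M S = lspan R M S"
proof
  show "mod_span R M S \<subseteq> lspan R M S"
  proof
    fix y assume "y \<in> mod_span R M S"
    then obtain a where a: "a \<in> S \<rightarrow> carrier R" and y: "y = (\<Oplus>\<^bsub>M\<^esub> m \<in> S. a m \<odot>\<^bsub>M\<^esub> m)"
      unfolding mod_span_def by blast
    have "(\<Oplus>\<^bsub>M\<^esub> m \<in> F. a m \<odot>\<^bsub>M\<^esub> m) \<in> lspan R M S" if "finite F" "F \<subseteq> S" for F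
      using that
    proof (induction F rule: finite_induct)
      case empty then show ?case by (simp add: lspan.zero)
    next
      case (insert x F)
      have "(\<lambda>m. a m \<odot>\<^bsub>M\<^esub> m) \<in> F \<rightarrow> carrier M" "a x \<odot>\<^bsub>M\<^esub> x \<in> carrier M"
        using a S insert.prems by (auto simp: Pi_def subset_iff)
      then have "(\<Oplus>\<^bsub>M\<^esub> m \<in> insert x F. a m \<odot>\<^bsub>M\<^esub> m) = a x \<odot>\<^bsub>M\<^esub> x \<oplus>\<^bsub>M\<^esub> (\<Oplus>\<^bsub>M\<^esub> m \<in> F. a m \<odot>\<^bsub>M\<^esub> m)"
        using insert.hyps by (intro M.finsum_insert) auto
      also have "\<dots> \<in> lspan R M S" using insert a by (intro lspan.step) auto
      finally show ?case .
    qed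
    then show "y \<in> lspan R M S" using S y by blast
  qed
  show "lspan R M S \<subseteq> mod_span R M S"
  proof
    fix y assume "y \<in> lspan R M S"
    then show "y \<in> mod_span R M S"
    proof (induction rule: lspan.induct)
      case zero
      have "(\<Oplus>\<^bsub>M\<^esub> m \<in> S. \<zero> \<odot>\<^bsub>M\<^esub> m) = \<zero>\<^bsub>M\<^esub>" using S by (intro M.add.finprod_one_eqI) auto
      then show ?case unfolding mod_span_def by (intro CollectI exI[of _ "\<lambda>_. \<zero>"]) auto
    next
      case (step b x y)
      then obtain a where a: "a \<in> S \<rightarrow> carrier R" and y: "y = (\<Oplus>\<^bsub>M\<^esub> m \<in> S. a m \<odot>\<^bsub>M\<^esub> m)"
        unfolding mod_span_def by blast
      define F where "F = S - {x}"
      have SF: "S = insert x F" and F: "finite F" "x \<notin> F" using step S unfolding F_def by auto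
      have ax: "a x \<in> carrier R" and xc: "x \<in> carrier M" using a step S by auto
      have am: "(\<lambda>m. a m \<odot>\<^bsub>M\<^esub> m) \<in> F \<rightarrow> carrier M" using a S SF by (auto simp: Pi_def subset_iff)
      \<comment> \<open>A sum over \<open>S\<close> allows one coefficient per element, so the new
        multiple of \<open>x\<close> is merged into the existing coefficient of
        \<open>x\<close>.\<close>
      let ?a = "a(x := b \<oplus> a x)"
      have eq: "(\<Oplus>\<^bsub>M\<^esub> m \<in> F. ?a m \<odot>\<^bsub>M\<^esub> m) = (\<Oplus>\<^bsub>M\<^esub> m \<in> F. a m \<odot>\<^bsub>M\<^esub> m)"
        using F am by (intro M.finsum_cong') auto
      have am': "(\<lambda>m. ?a m \<odot>\<^bsub>M\<^esub> m) \<in> F \<rightarrow> carrier M" using am F by (auto simp: Pi_def)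
      have "(\<Oplus>\<^bsub>M\<^esub> m \<in> S. ?a m \<odot>\<^bsub>M\<^esub> m) = (b \<oplus> a x) \<odot>\<^bsub>M\<^esub> x \<oplus>\<^bsub>M\<^esub> (\<Oplus>\<^bsub>M\<^esub> m \<in> F. a m \<odot>\<^bsub>M\<^esub> m)"
        unfolding SF using F am' ax xc step(1) eq by (subst M.finsum_insert) auto
      also have "\<dots> = b \<odot>\<^bsub>M\<^esub> x \<oplus>\<^bsub>M\<^esub> y"
        unfolding y SF using F am ax xc step(1)
        by (subst M.finsum_insert) (auto simp: smult_l_distr M.a_assoc)
      finally have "b \<odot>\<^bsub>M\<^esub> x \<oplus>\<^bsub>M\<^esub> y = (\<Oplus>\<^bsub>M\<^esub> m \<in> S. ?a m \<odot>\<^bsub>M\<^esub> m)" ..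
      moreover have "?a \<in> S \<rightarrow> carrier R" using a ax step(1) by auto
      ultimately show ?case unfolding mod_span_def by blast
    qed
  qed
qed

section \<open>Colon ideals and generation at a prime\<close>

text \<open>Two cases occur. For \<open>S = {u}\<close> and \<open>N\<close> the span of the other
  generators, it is the unit ideal exactly when \<open>u\<close> is redundant. For
  \<open>S = carrier M\<close> and \<open>M\<close> finitely generated, the primes containing it are
  those at which \<open>N\<close> is not locally all of \<open>M\<close>.\<close>

definition colon :: "'c set \<Rightarrow> 'c set \<Rightarrow> 'a set" where
  "colon N S = {a \<in> carrier R. \<forall>m\<in>S. a \<odot>\<^bsub>M\<^esub> m \<in> N}"

lemma colon_ideal:
  assumes N: "submodule N R M" and S: "S \<subseteq> carrier M" shows "ideal (colon N S) R"
proof (rule idealI)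
  note E = submoduleE[OF N]
  show "subgroup (colon N S) (add_monoid R)"
  proof (rule R.add.subgroupI)
    have "\<zero> \<in> colon N S" using S submodule_zero[OF N] by (auto simp: colon_def subset_iff)
    then show "colon N S \<noteq> {}" by blast
    fix a b assume ab: "a \<in> colon N S" "b \<in> colon N S"
    show "\<ominus> a \<in> colon N S" using ab S E(3) by (auto simp: colon_def smult_l_minus subset_iff)
    show "a \<oplus> b \<in> colon N S" using ab S E(5) by (auto simp: colon_def smult_l_distr subset_iff)
  qed (auto simp: colon_def)
  fix a r assume a: "a \<in> colon N S" and r: "r \<in> carrier R"
  then show "r \<otimes> a \<in> colon N S" using S E(4) by (auto simp: colon_def smult_assoc1 subset_iff)
  then show "a \<otimes> r \<in> colon N S" using a r R.m_comm[of a r] by (auto simp: colon_def)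
qed (fact R.ring_axioms)

lemma scaled_submodule:
  assumes N: "submodule N R M" and s: "s \<in> carrier R"
  shows "submodule {m \<in> carrier M. s \<odot>\<^bsub>M\<^esub> m \<in> N} R M"
proof (rule submoduleI_no_uminus)
  note E = submoduleE[OF N]
  fix x y a
  show "\<zero>\<^bsub>M\<^esub> \<in> {m \<in> carrier M. s \<odot>\<^bsub>M\<^esub> m \<in> N}" using s submodule_zero[OF N] by simp
  show "x \<oplus>\<^bsub>M\<^esub> y \<in> {m \<in> carrier M. s \<odot>\<^bsub>M\<^esub> m \<in> N}"
    if "x \<in> {m \<in> carrier M. s \<odot>\<^bsub>M\<^esub> m \<in> N}" "y \<in> {m \<in> carrier M. s \<odot>\<^bsub>M\<^esub> m \<in> N}"
    using that s E(5) by (auto simp: smult_r_distr)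
  show "a \<odot>\<^bsub>M\<^esub> x \<in> {m \<in> carrier M. s \<odot>\<^bsub>M\<^esub> m \<in> N}"
    if "a \<in> carrier R" "x \<in> {m \<in> carrier M. s \<odot>\<^bsub>M\<^esub> m \<in> N}"
  proof -
    have "s \<odot>\<^bsub>M\<^esub> (a \<odot>\<^bsub>M\<^esub> x) = a \<odot>\<^bsub>M\<^esub> (s \<odot>\<^bsub>M\<^esub> x)"
      using that s by (simp add: smult_assoc1[symmetric] R.m_comm)
    then show ?thesis using that E(4) by auto
  qed
qed auto

text \<open>This is \<open>loc_generates\<close> with \<open>lspan\<close> in place of
  \<open>mod_span\<close>; the two agree for finite subsets of the module.\<close>

definition lgen :: "'a set \<Rightarrow> 'c set \<Rightarrow> bool" where
  "lgen P G \<longleftrightarrow> (\<forall>m\<in>carrier M. \<exists>s\<in>carrier R - P. s \<odot>\<^bsub>M\<^esub> m \<in> lspan R M G)"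

text \<open>The product of the denominators for the finitely many members of \<open>G\<close> serves
  for all of \<open>M\<close>, and it stays outside \<open>P\<close> because \<open>P\<close> is
  prime.\<close>

lemma lgen_uniform:
  assumes P: "primeideal P R" and G: "finite G" "G \<subseteq> carrier M" "lspan R M G = carrier M"
    and T: "T \<subseteq> carrier M" "lgen P T"
  obtains s where "s \<in> carrier R" "s \<notin> P" "\<And>m. m \<in> carrier M \<Longrightarrow> s \<odot>\<^bsub>M\<^esub> m \<in> lspan R M T"
proof -
  interpret P: primeideal P R by fact
  have "\<exists>s\<in>carrier R - P. F \<subseteq> {m \<in> carrier M. s \<odot>\<^bsub>M\<^esub> m \<in> lspan R M T}"
    if "finite F" "F \<subseteq> carrier M" for F
    using that
  proof (induction F rule: finite_induct)
    case empty
    have "\<one> \<notin> P" by (rule P.one_notin)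
    then show ?case by auto
  next
    case (insert x F)
    then obtain s where s: "s \<in> carrier R" "s \<notin> P" "F \<subseteq> {m \<in> carrier M. s \<odot>\<^bsub>M\<^esub> m \<in> lspan R M T}"
      by auto
    obtain t where t: "t \<in> carrier R" "t \<notin> P" "t \<odot>\<^bsub>M\<^esub> x \<in> lspan R M T"
      using T(2) insert.prems unfolding lgen_def by blast
    have "(s \<otimes> t) \<odot>\<^bsub>M\<^esub> m \<in> lspan R M T" if "m \<in> insert x F" for m
    proof (cases "m = x")
      case True
      then have "(s \<otimes> t) \<odot>\<^bsub>M\<^esub> m = s \<odot>\<^bsub>M\<^esub> (t \<odot>\<^bsub>M\<^esub> x)" using s t insert.prems by (simp add: smult_assoc1)
      then show ?thesis using submoduleE(4)[OF lspan_submodule[OF T(1)]] s t by simp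
    next
      case False
      then have m: "m \<in> carrier M" "s \<odot>\<^bsub>M\<^esub> m \<in> lspan R M T" using that s by auto
      then have "(s \<otimes> t) \<odot>\<^bsub>M\<^esub> m = t \<odot>\<^bsub>M\<^esub> (s \<odot>\<^bsub>M\<^esub> m)"
        using s t by (simp add: R.m_comm[of s t] smult_assoc1)
      then show ?thesis using submoduleE(4)[OF lspan_submodule[OF T(1)]] m t by simp
    qed
    moreover have "s \<otimes> t \<in> carrier R - P" using s t P.I_prime by auto
    ultimately show ?case using insert.prems by blast
  qed
  from this[OF G(1,2)] obtain s where s: "s \<in> carrier R" "s \<notin> P"
    "G \<subseteq> {m \<in> carrier M. s \<odot>\<^bsub>M\<^esub> m \<in> lspan R M T}" by blast
  then have "lspan R M G \<subseteq> {m \<in> carrier M. s \<odot>\<^bsub>M\<^esub> m \<in> lspan R M T}"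
    by (intro lspan_least scaled_submodule lspan_submodule T(1))
  then show thesis using that s G(3) by blast
qed

text \<open>As \<open>c\<close> becomes a unit at \<open>P\<close>, the element \<open>z\<close> is
  locally in the span of \<open>Y'\<close> and can be eliminated from any local expression in
  \<open>z\<close> and \<open>Y\<close>.\<close>

lemma lgen_transfer:
  assumes P: "primeideal P R" and Y: "Y \<subseteq> Y'" "Y' \<subseteq> carrier M" and z: "z \<in> carrier M"
    and gen: "lgen P (insert z Y)" and c: "c \<in> carrier R" "c \<notin> P" "c \<odot>\<^bsub>M\<^esub> z \<in> lspan R M Y'"
  shows "lgen P Y'"
  unfolding lgen_def
proof
  fix m assume m: "m \<in> carrier M"
  have Yc: "Y \<subseteq> carrier M" using Y by blast
  obtain t where t: "t \<in> carrier R" "t \<notin> P" "t \<odot>\<^bsub>M\<^esub> m \<in> lspan R M (insert z Y)"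
    using gen m unfolding lgen_def by blast
  obtain d v where dv: "d \<in> carrier R" "v \<in> lspan R M Y" "t \<odot>\<^bsub>M\<^esub> m = d \<odot>\<^bsub>M\<^esub> z \<oplus>\<^bsub>M\<^esub> v"
    using lspan_insertE[OF t(3) z Yc] by blast
  have v: "v \<in> carrier M" "v \<in> lspan R M Y'"
    using dv(2) lspan_subset_carrier[OF Yc] lspan_mono[OF Y] by auto
  have "(c \<otimes> t) \<odot>\<^bsub>M\<^esub> m = c \<odot>\<^bsub>M\<^esub> (d \<odot>\<^bsub>M\<^esub> z) \<oplus>\<^bsub>M\<^esub> c \<odot>\<^bsub>M\<^esub> v"
    using c t m dv v z by (simp add: smult_assoc1 smult_r_distr)
  also have "c \<odot>\<^bsub>M\<^esub> (d \<odot>\<^bsub>M\<^esub> z) = d \<odot>\<^bsub>M\<^esub> (c \<odot>\<^bsub>M\<^esub> z)"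
    using c dv z by (simp add: smult_assoc1[symmetric] R.m_comm)
  also have "d \<odot>\<^bsub>M\<^esub> (c \<odot>\<^bsub>M\<^esub> z) \<oplus>\<^bsub>M\<^esub> c \<odot>\<^bsub>M\<^esub> v \<in> lspan R M Y'"
    using submoduleE(4,5)[OF lspan_submodule[OF Y(2)]] c dv(1) v by simp
  finally show "\<exists>s\<in>carrier R - P. s \<odot>\<^bsub>M\<^esub> m \<in> lspan R M Y'"
    using c t primeideal.I_prime[OF P, of c t] by blast
qed

text \<open>Steinitz exchange over the local ring at \<open>P\<close>: if the coefficient of \<open>z\<close> is in \<open>P\<close> for all
  members of \<open>G\<close>, then it is so for \<open>z\<close> itself, and \<open>z\<close> is superfluous.\<close>

lemma lgen_exchange:
  assumes P: "primeideal P R" and G: "G \<subseteq> carrier M" "lspan R M G = carrier M"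
    and Y: "Y \<subseteq> carrier M" and z: "z \<in> carrier M" and gen: "lgen P (insert z Y)"
  shows "lgen P Y \<or> (\<exists>g\<in>G. lgen P (insert g Y))"
proof -
  interpret P: primeideal P R by fact
  note Yc = lspan_subset_carrier[OF Y] and E = submoduleE[OF lspan_submodule[OF Y]]
  have one: "\<one> \<notin> P" by (rule P.one_notin)
  \<comment> \<open>\<open>L\<close> is the preimage in \<open>M\<close> of the submodule of the
    localization at \<open>P\<close> generated by \<open>Y\<close> and the multiples of
    \<open>z\<close> by \<open>P\<close>. Being a submodule, it is all of \<open>M\<close> as soon
    as it contains \<open>G\<close>.\<close>
  define L where "L = {m \<in> carrier M. \<exists>s\<in>carrier R - P. \<exists>c\<in>P. \<exists>w\<in>lspan R M Y.
    s \<odot>\<^bsub>M\<^esub> m = c \<odot>\<^bsub>M\<^esub> z \<oplus>\<^bsub>M\<^esub> w}"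
  have LI: "m \<in> L" if "m \<in> carrier M" "s \<in> carrier R" "s \<notin> P" "c \<in> P" "w \<in> lspan R M Y"
    "s \<odot>\<^bsub>M\<^esub> m = c \<odot>\<^bsub>M\<^esub> z \<oplus>\<^bsub>M\<^esub> w" for m s c w
    using that unfolding L_def by blast
  have LE: "\<exists>s c w. m \<in> carrier M \<and> s \<in> carrier R \<and> s \<notin> P \<and> c \<in> P \<and> c \<in> carrier R \<and> w \<in> lspan R M Y
    \<and> w \<in> carrier M \<and> s \<odot>\<^bsub>M\<^esub> m = c \<odot>\<^bsub>M\<^esub> z \<oplus>\<^bsub>M\<^esub> w" if "m \<in> L" for m
    using that Yc P.Icarr unfolding L_def by blast
  have L: "submodule L R M"
  proof (rule submoduleI_no_uminus)
    show "L \<subseteq> carrier M" unfolding L_def by blast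
    show "\<zero>\<^bsub>M\<^esub> \<in> L" using z one
      by (intro LI[of _ \<one> \<zero> "\<zero>\<^bsub>M\<^esub>"] lspan.zero) auto
  next
    fix x y assume "x \<in> L" "y \<in> L"
    then obtain s c w t d v where x: "x \<in> carrier M" "s \<in> carrier R" "s \<notin> P" "c \<in> P" "c \<in> carrier R"
      "w \<in> lspan R M Y" "w \<in> carrier M" "s \<odot>\<^bsub>M\<^esub> x = c \<odot>\<^bsub>M\<^esub> z \<oplus>\<^bsub>M\<^esub> w"
      and y: "y \<in> carrier M" "t \<in> carrier R" "t \<notin> P" "d \<in> P" "d \<in> carrier R"
      "v \<in> lspan R M Y" "v \<in> carrier M" "t \<odot>\<^bsub>M\<^esub> y = d \<odot>\<^bsub>M\<^esub> z \<oplus>\<^bsub>M\<^esub> v"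
      using LE[of x] LE[of y] by blast
    have "(s \<otimes> t) \<odot>\<^bsub>M\<^esub> (x \<oplus>\<^bsub>M\<^esub> y) = t \<odot>\<^bsub>M\<^esub> (s \<odot>\<^bsub>M\<^esub> x) \<oplus>\<^bsub>M\<^esub> s \<odot>\<^bsub>M\<^esub> (t \<odot>\<^bsub>M\<^esub> y)"
      using x(1,2) y(1,2) by (simp add: smult_assoc1[symmetric] smult_r_distr R.m_comm)
    also have "\<dots> = (t \<otimes> c \<oplus> s \<otimes> d) \<odot>\<^bsub>M\<^esub> z \<oplus>\<^bsub>M\<^esub> (t \<odot>\<^bsub>M\<^esub> w \<oplus>\<^bsub>M\<^esub> s \<odot>\<^bsub>M\<^esub> v)"
      unfolding x(8) y(8) using x(1-7) y(1-7) z
      by (simp add: smult_assoc1 smult_r_distr smult_l_distr M.a_ac)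
    finally show "x \<oplus>\<^bsub>M\<^esub> y \<in> L"
      using x y P.I_prime[of s t] E(4,5)
      by (intro LI[of _ "s \<otimes> t" "t \<otimes> c \<oplus> s \<otimes> d"]) (auto simp: P.I_l_closed)
  next
    fix a x assume a: "a \<in> carrier R" and "x \<in> L"
    then obtain s c w where x: "x \<in> carrier M" "s \<in> carrier R" "s \<notin> P" "c \<in> P" "c \<in> carrier R"
      "w \<in> lspan R M Y" "w \<in> carrier M" "s \<odot>\<^bsub>M\<^esub> x = c \<odot>\<^bsub>M\<^esub> z \<oplus>\<^bsub>M\<^esub> w"
      using LE[of x] by blast
    have "s \<odot>\<^bsub>M\<^esub> (a \<odot>\<^bsub>M\<^esub> x) = a \<odot>\<^bsub>M\<^esub> (s \<odot>\<^bsub>M\<^esub> x)"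
      using x(1,2) a by (simp add: smult_assoc1[symmetric] R.m_comm)
    also have "\<dots> = (a \<otimes> c) \<odot>\<^bsub>M\<^esub> z \<oplus>\<^bsub>M\<^esub> a \<odot>\<^bsub>M\<^esub> w"
      unfolding x(8) using x(1-7) a z by (simp add: smult_assoc1 smult_r_distr)
    finally show "a \<odot>\<^bsub>M\<^esub> x \<in> L"
      using x a E(4) by (intro LI[of _ s "a \<otimes> c"]) (auto simp: P.I_l_closed)
  qed
  show ?thesis
  proof (cases "G \<subseteq> L")
    case True
    then have "z \<in> L" using lspan_least[OF L True] z G by blast
    then obtain s c w where s: "s \<in> carrier R" "s \<notin> P" "c \<in> P" "c \<in> carrier R"
      "w \<in> lspan R M Y" "w \<in> carrier M" "s \<odot>\<^bsub>M\<^esub> z = c \<odot>\<^bsub>M\<^esub> z \<oplus>\<^bsub>M\<^esub> w"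
      using LE[of z] by blast
    \<comment> \<open>Solving the relation for \<open>z\<close> leaves the coefficient
      \<open>s \<oplus> \<ominus> c\<close>, which is outside \<open>P\<close> because
      \<open>c\<close> is in \<open>P\<close> and \<open>s\<close> is not; so \<open>z\<close> is
      locally in the span of \<open>Y\<close>.\<close>
    have "(s \<oplus> \<ominus> c) \<odot>\<^bsub>M\<^esub> z = s \<odot>\<^bsub>M\<^esub> z \<oplus>\<^bsub>M\<^esub> \<ominus>\<^bsub>M\<^esub> (c \<odot>\<^bsub>M\<^esub> z)"
      using s(1-6) z by (simp add: smult_l_distr smult_l_minus)
    also have "\<dots> = w" unfolding s(7) using s(1-6) z by (simp add: M.a_ac M.r_neg1 M.r_neg2 M.r_neg M.l_neg)
    finally have "(s \<oplus> \<ominus> c) \<odot>\<^bsub>M\<^esub> z \<in> lspan R M Y" using s by simp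
    moreover have "s \<oplus> \<ominus> c \<notin> P"
    proof
      assume "s \<oplus> \<ominus> c \<in> P"
      then have "(s \<oplus> \<ominus> c) \<oplus> c \<in> P" using s by simp
      moreover have "(s \<oplus> \<ominus> c) \<oplus> c = s" using s(1,4) by algebra
      ultimately show False using s by simp
    qed
    ultimately show ?thesis using lgen_transfer[OF P _ Y z gen, of "s \<oplus> \<ominus> c"] s by auto
  next
    case False
    then obtain g where g: "g \<in> G" "g \<notin> L" "g \<in> carrier M" using G by blast
    obtain s where s: "s \<in> carrier R" "s \<notin> P" "s \<odot>\<^bsub>M\<^esub> g \<in> lspan R M (insert z Y)"
      using gen g(3) unfolding lgen_def by blast
    obtain c w where c: "c \<in> carrier R" "w \<in> lspan R M Y" "s \<odot>\<^bsub>M\<^esub> g = c \<odot>\<^bsub>M\<^esub> z \<oplus>\<^bsub>M\<^esub> w"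
      using lspan_insertE[OF s(3) z Y] by blast
    \<comment> \<open>Otherwise the relation would put \<open>g\<close> into \<open>L\<close>. Thus
      \<open>c\<close> is invertible at \<open>P\<close>, and \<open>z\<close> is recovered from
      \<open>g\<close> and \<open>Y\<close>.\<close>
    have "c \<notin> P" using LI[OF g(3) s(1,2) _ c(2,3)] g(2) by blast
    have gY: "insert g Y \<subseteq> carrier M" using g Y by blast
    have w: "w \<in> carrier M" "w \<in> lspan R M (insert g Y)"
      using c(2) Yc lspan_mono[OF _ gY, of Y] by auto
    have "c \<odot>\<^bsub>M\<^esub> z = s \<odot>\<^bsub>M\<^esub> g \<ominus>\<^bsub>M\<^esub> w"
      unfolding c(3) using c(1) w z by (simp add: a_minus_def M.a_assoc M.r_neg)
    moreover have "s \<odot>\<^bsub>M\<^esub> g \<in> lspan R M (insert g Y)"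
      using submoduleE(4)[OF lspan_submodule[OF gY]] lspan_superset[OF gY] s by blast
    ultimately have "c \<odot>\<^bsub>M\<^esub> z \<in> lspan R M (insert g Y)"
      using submodule_minus[OF lspan_submodule[OF gY]] w by simp
    then have "lgen P (insert g Y)"
      by (intro lgen_transfer[OF P _ gY z gen c(1) \<open>c \<notin> P\<close>]) auto
    then show ?thesis using g by blast
  qed
qed

text \<open>Induction on the number of elements of \<open>T\<close> outside \<open>G\<close>: each
  exchange drops such an element or replaces it by a member of \<open>G\<close>, and never increases
  the cardinality.\<close>

lemma lgen_exchange_all:
  assumes P: "primeideal P R" and G: "G \<subseteq> carrier M" "lspan R M G = carrier M"
    and "finite T" "T \<subseteq> carrier M" "lgen P T"
  shows "\<exists>T'. finite T' \<and> T' \<subseteq> G \<and> card T' \<le> card T \<and> lgen P T'"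
  using assms(4-)
proof (induction "card (T - G)" arbitrary: T rule: less_induct)
  case less
  show ?case
  proof (cases "T \<subseteq> G")
    case False
    then obtain z where z: "z \<in> T" "z \<notin> G" by blast
    define Y where "Y = T - {z}"
    have T: "T = insert z Y" and Y: "finite Y" "z \<notin> Y" "Y \<subseteq> carrier M" "z \<in> carrier M"
      using z less.prems unfolding Y_def by auto
    have lt: "card (Y - G) < card (T - G)"
      using z Y less.prems(1) unfolding T by (intro psubset_card_mono) auto
    have cT: "card T = Suc (card Y)" using T Y by simp
    have "lgen P Y \<or> (\<exists>g\<in>G. lgen P (insert g Y))"
      using lgen_exchange[OF P G Y(3,4)] less.prems(3) T by simp
    then show ?thesis
    proof
      assume "lgen P Y"
      then obtain T' where "finite T'" "T' \<subseteq> G" "card T' \<le> card Y" "lgen P T'"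
        using less.hyps[OF lt Y(1,3)] by blast
      then show ?thesis using cT by (intro exI[of _ T']) simp
    next
      assume "\<exists>g\<in>G. lgen P (insert g Y)"
      then obtain g where g: "g \<in> G" "lgen P (insert g Y)" by blast
      have "insert g Y - G = Y - G" using g by blast
      moreover have "insert g Y \<subseteq> carrier M" using g Y G by blast
      ultimately obtain T' where "finite T'" "T' \<subseteq> G" "card T' \<le> card (insert g Y)" "lgen P T'"
        using less.hyps[of "insert g Y"] lt Y(1) g(2) by auto
      moreover have "card (insert g Y) \<le> card T" using Y(1) cT by (simp add: card_insert_if)
      ultimately show ?thesis by (meson le_trans)
    qed
  qed (use less.prems in blast)
qed

section \<open>Shifting the generators to make one of them redundant\<close>

text \<open>The families \<open>x'\<close> arising from \<open>x\<close> by adding multiples of \<open>u\<close> to its members enter only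
  through this consequence.\<close>

definition same_mod :: "'c \<Rightarrow> 'i set \<Rightarrow> ('i \<Rightarrow> 'c) \<Rightarrow> ('i \<Rightarrow> 'c) \<Rightarrow> bool" where
  "same_mod u I x x' \<longleftrightarrow> x' \<in> I \<rightarrow> carrier M \<and>
     (\<forall>K\<subseteq>I. lspan R M (insert u (x' ` K)) = lspan R M (insert u (x ` K)))"

lemma lspan_shift_subset:
  assumes u: "u \<in> carrier M" and x: "x \<in> K \<rightarrow> carrier M"
    and x': "\<And>i. i \<in> K \<Longrightarrow> \<exists>t\<in>carrier R. x' i = x i \<oplus>\<^bsub>M\<^esub> t \<odot>\<^bsub>M\<^esub> u"
  shows "lspan R M (insert u (x' ` K)) \<subseteq> lspan R M (insert u (x ` K))"
proof -
  have G: "insert u (x ` K) \<subseteq> carrier M" using u x by auto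
  note N = lspan_submodule[OF G]
  show ?thesis
  proof (rule lspan_least[OF N])
    have "x' i \<in> lspan R M (insert u (x ` K))" if i: "i \<in> K" for i
    proof -
      obtain t where t: "t \<in> carrier R" "x' i = x i \<oplus>\<^bsub>M\<^esub> t \<odot>\<^bsub>M\<^esub> u" using x'[OF i] by blast
      have "x i \<in> lspan R M (insert u (x ` K))" "u \<in> lspan R M (insert u (x ` K))"
        using lspan_superset[OF G] i by auto
      then show ?thesis unfolding t(2) using submoduleE(4,5)[OF N] t(1) by blast
    qed
    then show "insert u (x' ` K) \<subseteq> lspan R M (insert u (x ` K))"
      using lspan_superset[OF G] by blast
  qed
qed

text \<open>The shift is undone by the coefficients \<open>\<ominus> t i\<close>, so
  \<open>lspan_shift_subset\<close> applies in both directions.\<close>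

lemma same_mod_shift:
  assumes u: "u \<in> carrier M" and x: "x \<in> I \<rightarrow> carrier M" and t: "t \<in> I \<rightarrow> carrier R"
  shows "same_mod u I x (\<lambda>i. x i \<oplus>\<^bsub>M\<^esub> t i \<odot>\<^bsub>M\<^esub> u)"
proof -
  let ?x = "\<lambda>i. x i \<oplus>\<^bsub>M\<^esub> t i \<odot>\<^bsub>M\<^esub> u"
  have c: "?x \<in> I \<rightarrow> carrier M" using u x t by (auto simp: Pi_def)
  have "lspan R M (insert u (?x ` K)) = lspan R M (insert u (x ` K))" if K: "K \<subseteq> I" for K
  proof
    have xK: "x \<in> K \<rightarrow> carrier M" "?x \<in> K \<rightarrow> carrier M" "t \<in> K \<rightarrow> carrier R" using x c t K by auto
    show "lspan R M (insert u (?x ` K)) \<subseteq> lspan R M (insert u (x ` K))"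
      using xK by (intro lspan_shift_subset u) auto
    have "x i = ?x i \<oplus>\<^bsub>M\<^esub> (\<ominus> t i) \<odot>\<^bsub>M\<^esub> u" if "i \<in> K" for i
    proof -
      have "x i \<in> carrier M" "t i \<in> carrier R" using xK that by auto
      then show ?thesis using u by (simp add: smult_l_minus M.a_assoc M.r_neg)
    qed
    then have "\<exists>s\<in>carrier R. x i = ?x i \<oplus>\<^bsub>M\<^esub> s \<odot>\<^bsub>M\<^esub> u" if "i \<in> K" for i
      using that xK(3) by (intro bexI[of _ "\<ominus> t i"]) auto
    then show "lspan R M (insert u (x ` K)) \<subseteq> lspan R M (insert u (?x ` K))"
      by (intro lspan_shift_subset u xK)
  qed
  then show ?thesis using c unfolding same_mod_def by blast
qed

text \<open>The relations \<open>v x\<^sub>i = c\<^sub>i u + z\<^sub>i\<close> replace a minor \<open>v\<close> of a presentation matrix and its adjugate.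
  Shifting by multiples of \<open>v\<close> leaves the situation modulo \<open>v\<close> unchanged, and Kronecker's theorem
  for the \<open>c\<^sub>i\<close> and \<open>v\<^sup>2\<close> takes care of the primes not containing \<open>v\<close>.\<close>

lemma shift_step:
  assumes I: "finite I" and u: "u \<in> carrier M" and x: "x \<in> I \<rightarrow> carrier M" and S: "S \<subseteq> I"
    and D: "D \<subseteq> carrier R" "\<And>P. D \<subseteq> P \<Longrightarrow> \<not> prime_chain R P (card S)"
    and v: "v \<in> colon (lspan R M (insert u (x ` (I - S)))) (carrier M)"
  shows "\<exists>x'. same_mod u I x x' \<and> (\<forall>P. primeideal P R \<longrightarrow> D \<subseteq> P \<longrightarrow> colon (lspan R M (x' ` I)) {u} \<subseteq> P
    \<longrightarrow> v \<in> P \<and> colon (lspan R M (x ` I)) {u} \<subseteq> P)"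
proof -
  have vc: "v \<in> carrier R" using v unfolding colon_def by blast
  have xIS: "x ` (I - S) \<subseteq> carrier M" using x by auto
  \<comment> \<open>Since \<open>v\<close> carries all of \<open>M\<close> into the span of
    \<open>u\<close> and the generators outside \<open>S\<close>, each generator with index in
    \<open>S\<close> yields such a relation.\<close>
  have ex: "\<exists>c z. c \<in> carrier R \<and> z \<in> lspan R M (x ` (I - S)) \<and> v \<odot>\<^bsub>M\<^esub> x i = c \<odot>\<^bsub>M\<^esub> u \<oplus>\<^bsub>M\<^esub> z"
    if "i \<in> S" for i
  proof -
    have "x i \<in> carrier M" using that x S by auto
    then have "v \<odot>\<^bsub>M\<^esub> x i \<in> lspan R M (insert u (x ` (I - S)))" using v unfolding colon_def by blast
    then show ?thesis by (rule lspan_insertE[OF _ u xIS]) blast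
  qed
  have "\<exists>c. \<forall>i\<in>S. \<exists>z. c i \<in> carrier R \<and> z \<in> lspan R M (x ` (I - S)) \<and> v \<odot>\<^bsub>M\<^esub> x i = c i \<odot>\<^bsub>M\<^esub> u \<oplus>\<^bsub>M\<^esub> z"
    by (rule bchoice) (use ex in blast)
  then obtain c where "\<forall>i\<in>S. \<exists>z. c i \<in> carrier R \<and> z \<in> lspan R M (x ` (I - S)) \<and> v \<odot>\<^bsub>M\<^esub> x i = c i \<odot>\<^bsub>M\<^esub> u \<oplus>\<^bsub>M\<^esub> z" ..
  from bchoice[OF this] obtain z where cz: "\<And>i. i \<in> S \<Longrightarrow> c i \<in> carrier R"
    "\<And>i. i \<in> S \<Longrightarrow> z i \<in> lspan R M (x ` (I - S))"
    "\<And>i. i \<in> S \<Longrightarrow> v \<odot>\<^bsub>M\<^esub> x i = c i \<odot>\<^bsub>M\<^esub> u \<oplus>\<^bsub>M\<^esub> z i" by blast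
  obtain y where y: "y \<in> S \<rightarrow> carrier R" and kr: "\<And>P. primeideal P R \<Longrightarrow> D \<subseteq> P \<Longrightarrow>
      (\<forall>i\<in>S. c i \<oplus> (v \<otimes> v) \<otimes> y i \<in> P) \<Longrightarrow> v \<otimes> v \<in> P"
    using bexE[OF R.kronecker[OF finite_subset[OF S I] D(1) _ R.m_closed[OF vc vc] D(2)], of c] cz(1) by blast
  \<comment> \<open>One factor of \<open>v \<otimes> v\<close> is used in the shift; the other
    arises on multiplying \<open>x' i\<close> by \<open>v\<close>. Outside \<open>S\<close> nothing
    moves, so the elements \<open>z i\<close> remain in the span of the new family.\<close>
  define t where "t i = (if i \<in> S then v \<otimes> y i else \<zero>)" for i
  define x' where "x' i = x i \<oplus>\<^bsub>M\<^esub> t i \<odot>\<^bsub>M\<^esub> u" for i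
  have tc: "t \<in> I \<rightarrow> carrier R" using y vc by (auto simp: t_def Pi_def)
  have same: "same_mod u I x x'" unfolding x'_def[abs_def] by (rule same_mod_shift[OF u x tc])
  have x'c: "x' ` I \<subseteq> carrier M" using same unfolding same_mod_def by auto
  note N = lspan_submodule[OF x'c]
  have "x' ` (I - S) = x ` (I - S)"
    using x u by (intro image_cong) (auto simp: x'_def t_def Pi_def)
  then have sub: "lspan R M (x ` (I - S)) \<subseteq> lspan R M (x' ` I)"
    using lspan_mono[OF _ x'c, of "x ` (I - S)"] by blast
  have b: "c i \<oplus> (v \<otimes> v) \<otimes> y i \<in> colon (lspan R M (x' ` I)) {u}" if i: "i \<in> S" for i
  proof -
    have [simp]: "c i \<in> carrier R" "y i \<in> carrier R" "x i \<in> carrier M" "z i \<in> carrier M" "v \<in> carrier R"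
      using cz i y x S vc lspan_subset_carrier[OF xIS] by auto
    have "x' i \<in> lspan R M (x' ` I)" using lspan_superset[OF x'c] i S by blast
    then have "v \<odot>\<^bsub>M\<^esub> x' i \<ominus>\<^bsub>M\<^esub> z i \<in> lspan R M (x' ` I)"
      by (rule submodule_minus[OF N submoduleE(4)[OF N vc] subsetD[OF sub cz(2)[OF i]]])
    moreover have "v \<odot>\<^bsub>M\<^esub> x' i = (c i \<oplus> (v \<otimes> v) \<otimes> y i) \<odot>\<^bsub>M\<^esub> u \<oplus>\<^bsub>M\<^esub> z i"
      using i u by (simp add: x'_def t_def smult_r_distr cz(3) smult_l_distr smult_assoc1 M.a_ac)
    then have "v \<odot>\<^bsub>M\<^esub> x' i \<ominus>\<^bsub>M\<^esub> z i = (c i \<oplus> (v \<otimes> v) \<otimes> y i) \<odot>\<^bsub>M\<^esub> u"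
      using u by (simp add: a_minus_def M.a_assoc M.r_neg)
    ultimately show ?thesis unfolding colon_def by simp
  qed
  \<comment> \<open>All shifts are by multiples of \<open>v\<close>, so an element of the old span
    enters the new one after adding a multiple of \<open>v\<close> times \<open>u\<close>. Hence a
    prime containing \<open>v\<close> and the new colon ideal of \<open>u\<close> also contains the
    old one.\<close>
  have lift: "\<exists>d\<in>carrier R. w \<oplus>\<^bsub>M\<^esub> (v \<otimes> d) \<odot>\<^bsub>M\<^esub> u \<in> lspan R M (x' ` I)" if "w \<in> lspan R M (x ` I)" for w
    using that
  proof (induction rule: lspan.induct)
    case zero
    show ?case using u vc by (intro bexI[of _ \<zero>]) (auto intro: lspan.zero)
  next
    case (step a g w)
    then obtain i d where i: "i \<in> I" "g = x i" and d: "d \<in> carrier R"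
      "w \<oplus>\<^bsub>M\<^esub> (v \<otimes> d) \<odot>\<^bsub>M\<^esub> u \<in> lspan R M (x' ` I)" by blast
    have w: "w \<in> carrier M" using step lspan_subset_carrier[of "x ` I"] x by auto
    have xi: "x i \<in> carrier M" using i x by auto
    have "\<exists>s\<in>carrier R. t i = v \<otimes> s"
      using y vc by (intro bexI[of _ "if i \<in> S then y i else \<zero>"]) (auto simp: t_def)
    then obtain s where s: "s \<in> carrier R" "t i = v \<otimes> s" by blast
    have "a \<odot>\<^bsub>M\<^esub> x' i \<oplus>\<^bsub>M\<^esub> (w \<oplus>\<^bsub>M\<^esub> (v \<otimes> d) \<odot>\<^bsub>M\<^esub> u) \<in> lspan R M (x' ` I)"
      using step(1) i d by (intro lspan.step) auto
    also have "a \<odot>\<^bsub>M\<^esub> x' i = a \<odot>\<^bsub>M\<^esub> x i \<oplus>\<^bsub>M\<^esub> (v \<otimes> (a \<otimes> s)) \<odot>\<^bsub>M\<^esub> u"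
      using step(1) xi s u vc by (simp add: x'_def smult_r_distr smult_assoc1[symmetric] R.m_ac)
    also have "a \<odot>\<^bsub>M\<^esub> x i \<oplus>\<^bsub>M\<^esub> (v \<otimes> (a \<otimes> s)) \<odot>\<^bsub>M\<^esub> u \<oplus>\<^bsub>M\<^esub> (w \<oplus>\<^bsub>M\<^esub> (v \<otimes> d) \<odot>\<^bsub>M\<^esub> u)
      = a \<odot>\<^bsub>M\<^esub> x i \<oplus>\<^bsub>M\<^esub> w \<oplus>\<^bsub>M\<^esub> (v \<otimes> (a \<otimes> s \<oplus> d)) \<odot>\<^bsub>M\<^esub> u"
      using step(1) xi s u vc d(1) w by (simp add: R.r_distr smult_l_distr M.a_ac)
    finally show ?case using i(2) s(1) d(1) step(1) by (intro bexI[of _ "a \<otimes> s \<oplus> d"]) auto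
  qed
  have "v \<in> P \<and> colon (lspan R M (x ` I)) {u} \<subseteq> P"
    if P: "primeideal P R" "D \<subseteq> P" "colon (lspan R M (x' ` I)) {u} \<subseteq> P" for P
  proof -
    interpret P: primeideal P R by fact
    have "v \<otimes> v \<in> P" using kr[OF P(1,2)] b P(3) by blast
    then have vP: "v \<in> P" using P.I_prime vc by blast
    have "a \<in> P" if "a \<in> colon (lspan R M (x ` I)) {u}" for a
    proof -
      have a: "a \<in> carrier R" "a \<odot>\<^bsub>M\<^esub> u \<in> lspan R M (x ` I)" using that by (auto simp: colon_def)
      obtain d where d: "d \<in> carrier R" "a \<odot>\<^bsub>M\<^esub> u \<oplus>\<^bsub>M\<^esub> (v \<otimes> d) \<odot>\<^bsub>M\<^esub> u \<in> lspan R M (x' ` I)"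
        using lift[OF a(2)] by blast
      then have "a \<oplus> v \<otimes> d \<in> colon (lspan R M (x' ` I)) {u}"
        using a u vc by (simp add: colon_def smult_l_distr)
      then have "a \<oplus> v \<otimes> d \<in> P" using P(3) by blast
      moreover have "\<ominus> (v \<otimes> d) \<in> P" using vP d P.I_r_closed by simp
      ultimately have "(a \<oplus> v \<otimes> d) \<oplus> \<ominus> (v \<otimes> d) \<in> P" by (rule P.a_closed)
      moreover have "(a \<oplus> v \<otimes> d) \<oplus> \<ominus> (v \<otimes> d) = a" using a(1) vc d(1) by algebra
      ultimately show ?thesis by simp
    qed
    then show ?thesis using vP by blast
  qed
  then show ?thesis using same by blast
qed

text \<open>At each prime in question some \<open>S\<close> in \<open>F\<close> provides a
  multiplier outside the prime; the sets in \<open>F\<close> are used up one at a time. By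
  \<open>same_mod\<close>, the colon ideals with \<open>carrier M\<close> do not change under the
  shifts, so the covering hypothesis can be passed on.\<close>

lemma shift_steps:
  assumes I: "finite I" and u: "u \<in> carrier M" and D: "D \<subseteq> carrier R" "\<And>P. D \<subseteq> P \<Longrightarrow> \<not> prime_chain R P k"
    and F: "finite F" and FS: "\<And>S. S \<in> F \<Longrightarrow> S \<subseteq> I \<and> card S = k" and x: "x \<in> I \<rightarrow> carrier M"
    and cover: "\<And>P. primeideal P R \<Longrightarrow> D \<subseteq> P \<Longrightarrow> colon (lspan R M (x ` I)) {u} \<subseteq> P \<Longrightarrow>
      \<exists>S\<in>F. \<not> colon (lspan R M (insert u (x ` (I - S)))) (carrier M) \<subseteq> P"
  shows "\<exists>x'. same_mod u I x x' \<and> (\<forall>P. primeideal P R \<longrightarrow> D \<subseteq> P \<longrightarrow> \<not> colon (lspan R M (x' ` I)) {u} \<subseteq> P)"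
  using F FS x cover
proof (induction F arbitrary: x rule: finite_induct)
  case empty
  then show ?case by (intro exI[of _ x]) (auto simp: same_mod_def)
next
  case (insert S F)
  note x = insert.prems(2)
  let ?N = "\<lambda>x. colon (lspan R M (x ` I)) {u}"
  let ?A = "\<lambda>x S. colon (lspan R M (insert u (x ` (I - S)))) (carrier M)"
  have S: "S \<subseteq> I" "card S = k" using insert.prems(1) by auto
  have A: "ideal (?A x S) R" using u x by (intro colon_ideal lspan_submodule) auto
  \<comment> \<open>By the covering hypothesis no prime contains both \<open>?A x S\<close> and
    \<open>Y\<close>, whence \<open>\<one> = v \<oplus> w\<close>. A prime left over after the shift
    for \<open>v\<close> contains \<open>v\<close>, hence not \<open>w\<close>, and so fails to
    contain the colon ideal of some remaining member of \<open>F\<close>.\<close>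
  define Y where "Y = D \<union> ?N x \<union> (\<Union>S\<in>F. ?A x S)"
  have Y: "Y \<subseteq> carrier R" using D(1) unfolding Y_def colon_def by auto
  have "\<one> \<in> Idl (?A x S \<union> Idl Y)"
  proof (rule R.one_mem_Idl_if_no_primeideal)
    show "?A x S \<union> Idl Y \<subseteq> carrier R"
      using ideal.Icarr[OF A] ideal.Icarr[OF R.genideal_ideal[OF Y]] by blast
    fix P assume P: "primeideal P R"
    show "\<not> ?A x S \<union> Idl Y \<subseteq> P"
    proof
      assume sub: "?A x S \<union> Idl Y \<subseteq> P"
      then have "Y \<subseteq> P" using R.genideal_self[OF Y] by blast
      then have "D \<subseteq> P" "?N x \<subseteq> P" "\<And>S. S \<in> F \<Longrightarrow> ?A x S \<subseteq> P" unfolding Y_def by auto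
      then show False using insert.prems(3)[OF P] sub by auto
    qed
  qed
  then obtain v w where v: "v \<in> ?A x S" and w: "w \<in> Idl Y" and one: "\<one> = v \<oplus> w"
    unfolding R.union_genideal[OF A R.genideal_ideal[OF Y]] by (auto simp: set_add_defs)
  obtain x' where x': "same_mod u I x x'"
    and step: "\<And>P. primeideal P R \<Longrightarrow> D \<subseteq> P \<Longrightarrow> ?N x' \<subseteq> P \<Longrightarrow> v \<in> P \<and> ?N x \<subseteq> P"
    using shift_step[OF I u x S(1) D(1) _ v] D(2) S(2) by blast
  have x'c: "x' \<in> I \<rightarrow> carrier M" and eq: "\<And>S. ?A x' S = ?A x S"
    using x' unfolding same_mod_def by auto
  have "\<exists>S\<in>F. \<not> ?A x' S \<subseteq> P" if P: "primeideal P R" "D \<subseteq> P" "?N x' \<subseteq> P" for P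
  proof (rule ccontr)
    assume "\<not> ?thesis"
    then have "Y \<subseteq> P" using step[OF P] P(2) unfolding eq Y_def by blast
    interpret P: primeideal P R by fact
    have "w \<in> P" using w R.genideal_minimal[OF P.is_ideal \<open>Y \<subseteq> P\<close>] by blast
    then have "\<one> \<in> P" unfolding one using step[OF P] by auto
    then show False using P.one_notin by contradiction
  qed
  then obtain x'' where "same_mod u I x' x''"
    "\<forall>P. primeideal P R \<longrightarrow> D \<subseteq> P \<longrightarrow> \<not> ?N x'' \<subseteq> P"
    using insert.IH[OF _ x'c] insert.prems(1) by auto
  moreover from this have "same_mod u I x x''" using x' unfolding same_mod_def by auto
  ultimately show ?case by blast
qed

text \<open>\<open>D k\<close> cuts out the primes at which more than \<open>card I - k\<close> generators are needed; these strata
  are treated in the order of decreasing number of generators.\<close>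

lemma remove_generator:
  assumes I: "finite I" and u: "u \<in> carrier M" and x: "x \<in> I \<rightarrow> carrier M"
    and gen: "lspan R M (insert u (x ` I)) = carrier M"
    and bound: "\<And>P n. prime_chain R P n \<Longrightarrow>
      \<exists>T. finite T \<and> T \<subseteq> carrier M \<and> lgen P T \<and> card T + n \<le> card I"
  obtains x' where "x' \<in> I \<rightarrow> carrier M" "lspan R M (x' ` I) = carrier M"
proof -
  define D where "D k = {s \<in> carrier R. \<exists>T. finite T \<and> T \<subseteq> carrier M \<and> card T + k \<le> card I \<and>
    (\<forall>m\<in>carrier M. s \<odot>\<^bsub>M\<^esub> m \<in> lspan R M T)}" for k
  let ?N = "\<lambda>x. colon (lspan R M (x ` I)) {u}"
  have Dc: "D k \<subseteq> carrier R" for k unfolding D_def by blast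
  have G: "finite (insert u (x ` I))" "insert u (x ` I) \<subseteq> carrier M" using I u x by auto
  \<comment> \<open>At a prime with a chain of length \<open>k\<close>, \<open>bound\<close> leaves
    room for at most \<open>card I - k\<close> local generators; clearing denominators gives an
    element of \<open>D k\<close> outside \<open>P\<close>.\<close>
  have noch: "\<not> prime_chain R P k" if DP: "D k \<subseteq> P" for P k
  proof
    assume ch: "prime_chain R P k"
    then obtain T where T: "finite T" "T \<subseteq> carrier M" "lgen P T" "card T + k \<le> card I"
      using bound by blast
    obtain s where "s \<in> carrier R" "s \<notin> P" "\<And>m. m \<in> carrier M \<Longrightarrow> s \<odot>\<^bsub>M\<^esub> m \<in> lspan R M T"
      using lgen_uniform[OF prime_chain_primeideal[OF ch] G gen T(2,3)] by blast
    then have "s \<in> D k" using T unfolding D_def by blast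
    then show False using DP \<open>s \<notin> P\<close> by blast
  qed
  have "\<exists>x'. same_mod u I x x' \<and> (\<forall>P. primeideal P R \<longrightarrow> D k \<subseteq> P \<longrightarrow> \<not> ?N x' \<subseteq> P)" for k
  proof (induction k)
    case 0
    show ?case using noch[of 0] x prime_chain_0 by (intro exI[of _ x]) (auto simp: same_mod_def)
  next
    case (Suc k)
    then obtain x' where x': "same_mod u I x x'"
      and IH: "\<And>P. primeideal P R \<Longrightarrow> D k \<subseteq> P \<Longrightarrow> \<not> ?N x' \<subseteq> P" by blast
    have x'c: "x' \<in> I \<rightarrow> carrier M" and gen': "lspan R M (insert u (x' ` I)) = carrier M"
      using x' gen unfolding same_mod_def by auto
    have G': "finite (insert u (x' ` I))" "insert u (x' ` I) \<subseteq> carrier M" using I u x'c by auto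
    let ?F = "{S. S \<subseteq> I \<and> card S = Suc k}"
    have "\<exists>S\<in>?F. \<not> colon (lspan R M (insert u (x' ` (I - S)))) (carrier M) \<subseteq> P"
      if P: "primeideal P R" "D (Suc k) \<subseteq> P" "?N x' \<subseteq> P" for P
    proof -
      \<comment> \<open>By the induction hypothesis a prime containing the colon ideal of
        \<open>u\<close> cannot contain \<open>D k\<close>. So \<open>card I - k\<close> generators
        suffice at \<open>P\<close>, and by exchange they may be taken from \<open>u\<close> and the
        current family.\<close>
      obtain s where s: "s \<in> D k" "s \<notin> P" using IH[OF P(1)] P(3) by blast
      then obtain T where T: "finite T" "T \<subseteq> carrier M" "card T + k \<le> card I" "lgen P T"
        unfolding D_def lgen_def by blast
      obtain T' where T': "finite T'" "T' \<subseteq> insert u (x' ` I)" "card T' \<le> card T" "lgen P T'"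
        using lgen_exchange_all[OF P(1) G'(2) gen' T(1,2,4)] by blast
      have T'c: "T' \<subseteq> carrier M" using T' G' by blast
      \<comment> \<open>Otherwise a multiple of \<open>u\<close> by an element outside
        \<open>P\<close> would lie in the span of the family. As \<open>u\<close> takes one place,
        at most \<open>card I - Suc k\<close> indices are used, which leaves \<open>Suc k\<close>
        indices for \<open>S\<close>.\<close>
      have uT: "u \<in> T'"
      proof (rule ccontr)
        assume "u \<notin> T'"
        then have "T' \<subseteq> x' ` I" using T'(2) by blast
        then have "lspan R M T' \<subseteq> lspan R M (x' ` I)" using G'(2) by (intro lspan_mono) auto
        moreover obtain r where "r \<in> carrier R" "r \<notin> P" "r \<odot>\<^bsub>M\<^esub> u \<in> lspan R M T'"
          using T'(4) u unfolding lgen_def by blast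
        ultimately show False using P(3) unfolding colon_def by blast
      qed
      have "T' - {u} \<subseteq> x' ` I" using T'(2) by blast
      \<comment> \<open>The indices are chosen injectively because \<open>x'\<close> may take a
        value several times.\<close>
      then obtain K where K: "K \<subseteq> I" "inj_on x' K" "T' - {u} = x' ` K"
        by (meson subset_image_inj)
      have "card K = card T' - 1" using K uT T'(1) by (metis card_image card_Diff_singleton)
      moreover have "card T' > 0" using uT T'(1) by (auto simp: card_gt_0_iff)
      ultimately have "card K + Suc k \<le> card I" using T(3) T'(3) by linarith
      then have "Suc k \<le> card (I - K)" using K(1) I by (simp add: card_Diff_subset finite_subset)
      then obtain S where S: "S \<subseteq> I - K" "card S = Suc k" by (meson obtain_subset_with_card_n)
      have "T' \<subseteq> insert u (x' ` (I - S))" using K S by blast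
      then have "lspan R M T' \<subseteq> lspan R M (insert u (x' ` (I - S)))"
        using G'(2) by (intro lspan_mono) auto
      moreover obtain r where "r \<in> carrier R" "r \<notin> P" "\<And>m. m \<in> carrier M \<Longrightarrow> r \<odot>\<^bsub>M\<^esub> m \<in> lspan R M T'"
        using lgen_uniform[OF P(1) G gen T'c T'(4)] by blast
      ultimately have "\<not> colon (lspan R M (insert u (x' ` (I - S)))) (carrier M) \<subseteq> P"
        unfolding colon_def by blast
      then show ?thesis using S by blast
    qed
    with I have "\<exists>x''. same_mod u I x' x'' \<and> (\<forall>P. primeideal P R \<longrightarrow> D (Suc k) \<subseteq> P \<longrightarrow> \<not> ?N x'' \<subseteq> P)"
      by (intro shift_steps[where k = "Suc k" and F = ?F, OF I u Dc noch _ _ x'c]) simp_all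
    then obtain x'' where "same_mod u I x' x''"
      "\<forall>P. primeideal P R \<longrightarrow> D (Suc k) \<subseteq> P \<longrightarrow> \<not> ?N x'' \<subseteq> P"
      by blast
    moreover from this have "same_mod u I x x''" using x' unfolding same_mod_def by auto
    ultimately show ?case by blast
  qed
  \<comment> \<open>\<open>D (Suc (card I))\<close> is empty, since no \<open>T\<close> meets the
    cardinality condition; its inclusion in \<open>P\<close> is automatic, and every prime is
    covered.\<close>
  from this[of "Suc (card I)"] obtain x' where x': "same_mod u I x x'"
    and none: "\<And>P. primeideal P R \<Longrightarrow> \<not> ?N x' \<subseteq> P" unfolding D_def by auto
  have x'c: "x' \<in> I \<rightarrow> carrier M" "x' ` I \<subseteq> carrier M" and gen': "lspan R M (insert u (x' ` I)) = carrier M"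
    using x' gen unfolding same_mod_def by auto
  have N: "ideal (?N x') R" using u by (intro colon_ideal lspan_submodule x'c) auto
  have "\<one> \<in> Idl (?N x')"
    using none by (intro R.one_mem_Idl_if_no_primeideal) (auto simp: colon_def)
  then have "\<one> \<in> ?N x'" using R.genideal_minimal[OF N] by blast
  then have "u \<in> lspan R M (x' ` I)" using u by (simp add: colon_def)
  then have "lspan R M (insert u (x' ` I)) \<subseteq> lspan R M (x' ` I)"
    using lspan_superset[OF x'c(2)] by (intro lspan_least lspan_submodule x'c) auto
  then show thesis using that[OF x'c(1)] gen' lspan_subset_carrier[OF x'c(2)] by blast
qed

section \<open>The Forster-Swan bound\<close>

text \<open>Generators are removed one at a time as long as their number exceeds
  \<open>e_inv R M\<close>. If \<open>e_inv R M\<close> is infinite, any finite generating set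
  already satisfies the bound.\<close>

theorem forster_swan:
  assumes "fin_gen_module R M"
  shows "\<exists>S. finite S \<and> S \<subseteq> carrier M \<and> mod_span R M S = carrier M \<and> enat (card S) \<le> e_inv R M"
proof -
  obtain G where G: "finite G" "G \<subseteq> carrier M" "lspan R M G = carrier M"
    using assms mod_span_eq_lspan unfolding fin_gen_module_def by auto
  have lgen: "loc_generates R M P T \<longleftrightarrow> lgen P T" if "finite T" "T \<subseteq> carrier M" for P T
    using that unfolding loc_generates_def lgen_def by (simp add: mod_span_eq_lspan)
  \<comment> \<open>The finite set \<open>G\<close> generates at every prime, so the minimum in
    \<open>mu_loc\<close> is attained.\<close>
  have mu: "\<exists>T. finite T \<and> T \<subseteq> carrier M \<and> card T = mu_loc R M P \<and> lgen P T" if P: "primeideal P R" for P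
  proof -
    have "\<one> \<notin> P" by (rule primeideal.one_notin[OF P])
    then have "lgen P G" unfolding lgen_def G(3) by (intro ballI bexI[of _ \<one>]) auto
    then have "\<exists>n T. finite T \<and> T \<subseteq> carrier M \<and> card T = n \<and> loc_generates R M P T"
      using G lgen[OF G(1,2)] by (intro exI[of _ "card G"] exI[of _ G]) simp
    from LeastI_ex[OF this] obtain T where "finite T" "T \<subseteq> carrier M" "card T = mu_loc R M P" "loc_generates R M P T"
      unfolding mu_loc_def by blast
    then show ?thesis using lgen by blast
  qed
  \<comment> \<open>A chain of length \<open>n\<close> at \<open>P\<close> makes the dimension in
    the summand of \<open>e_inv\<close> at \<open>P\<close> at least \<open>n\<close>. The natural
    number \<open>q\<close> stands for the number of generators that are to remain.\<close>
  have bound: "\<exists>T. finite T \<and> T \<subseteq> carrier M \<and> lgen P T \<and> card T + n \<le> q"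
    if q: "e_inv R M \<le> enat q" and ch: "prime_chain R P n" for P n q
  proof -
    note P = prime_chain_primeideal[OF ch]
    have "enat (mu_loc R M P) + enat n \<le> enat (mu_loc R M P) + krull_dim (R Quot P)"
      by (intro add_left_mono R.krull_dim_Quot_ge ch)
    also have "\<dots> \<le> e_inv R M" unfolding e_inv_def using P by (intro SUP_upper) simp
    also note q
    finally have "mu_loc R M P + n \<le> q" by simp
    moreover obtain T where "finite T" "T \<subseteq> carrier M" "card T = mu_loc R M P" "lgen P T"
      using mu[OF P] by blast
    ultimately show ?thesis by (intro exI[of _ T]) simp
  qed
  have "\<exists>S. finite S \<and> S \<subseteq> carrier M \<and> lspan R M S = carrier M \<and> enat (card S) \<le> e_inv R M"
    using G
  proof (induction "card G" arbitrary: G rule: less_induct)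
    case less
    show ?case
    proof (cases "enat (card G) \<le> e_inv R M")
      case False
      have "G \<noteq> {}"
      proof
        assume "G = {}"
        then have "enat (card G) = 0" by (simp add: zero_enat_def)
        then show False using False by simp
      qed
      then obtain u where u: "u \<in> G" by blast
      define I where "I = G - {u}"
      have I: "finite I" "u \<notin> I" "I \<subseteq> carrier M" "u \<in> carrier M" "insert u I = G"
        using less.prems u unfolding I_def by auto
      then have cG: "card G = Suc (card I)" using card_insert_disjoint by metis
      \<comment> \<open>The failed bound is a strict inequality, so \<open>e_inv R M\<close> is
        still at most the number of generators other than \<open>u\<close>.\<close>
      have q: "e_inv R M \<le> enat (card I)" using False cG by (cases "e_inv R M") auto
      obtain x' where x': "x' \<in> I \<rightarrow> carrier M" "lspan R M (x' ` I) = carrier M"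
        using remove_generator[OF I(1,4), of "\<lambda>i. i"] I less.prems(3) bound[OF q] by auto
      have "card (x' ` I) < card G" using cG card_image_le[OF I(1), of x'] by simp
      then show ?thesis using less.hyps[of "x' ` I"] x' I(1) by auto
    qed (use less.prems in blast)
  qed
  then obtain S where "finite S" "S \<subseteq> carrier M" "lspan R M S = carrier M" "enat (card S) \<le> e_inv R M"
    by blast
  then show ?thesis by (intro exI[of _ S]) (simp add: mod_span_eq_lspan)
qed

end

theorem theorem4p1:
  fixes R :: "('a, 'b) ring_scheme" and I :: "'a set" and d :: nat
    and A :: "(int \<Rightarrow> 'a) ring" and M :: "(int \<Rightarrow> 'a, 'm) module"
  assumes "noetherian_domain R"
    and "krull_dim R = enat d"
    and "ideal I R"
    and "A = rees_algebra R I \<or> A = ext_rees_algebra R I"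
    and "module A M"
    and "carrier M \<noteq> {\<zero>\<^bsub>M\<^esub>}"
    and "fin_gen_module A M"
  shows "\<exists>S. finite S \<and> S \<subseteq> carrier M \<and> mod_span A M S = carrier M
             \<and> enat (card S) \<le> e_inv A M"
  using module.forster_swan[OF assms(5,7)] .

end
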